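(* Let $k$, $m$ and $s$ be positive integers with $s\le m+1$. Then for all integers $n\ge 0$: \begin{align*} p_{[1,2;-(3^{k+m}-2b)/b]}\left(3^{2s} n+3^{2s-1} r+\frac{3^{2s}-1}{4}\right)&\equiv 0 \pmod{3^{k+m-s+1}}, && r\in\{1,2\},\\ p_{[1,3;-(5^{k+m}-2b)/b]}\left(5^{2s} n+5^{2s-1} r+\frac{2\cdot 5^{2s-1}-1}{3}\right)&\equiv 0 \pmod{5^{k+m-s+1}}, && r\in\{0,2,3,4\}, \end{align*} where in each congruence $b$ is any positive integer coprime to the modulus (i.e. to $3$, $5$ respectively).
   Context: For a rational number $t$ and an integer $u>1$, the rational numbers $p_{[1,u;t]}(n)$, $n\ge 0$, are defined by the formal power series identity $\sum_{n\ge 0}p_{[1,u;t]}(n)q^n=\prod_{j\ge 1}\big((1-q^j)(1-q^{uj})\big)^t$, where each power is the binomial series with constant term $1$. For a prime $\ell$ not dividing the denominator of $t$, a congruence $p_{[1,u;t]}(N)\equiv 0\pmod{\ell^k}$ means that the numerator of $p_{[1,u;t]}(N)$, written as a reduced fraction, is divisible by $\ell^k$ (the denominator is then coprime to $\ell$). *)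

theory Defs
  imports "HOL-Analysis.Analysis" "HOL-Computational_Algebra.Formal_Power_Series"
begin

text \<open>
  The power \<open>f\<^sup>t = (\<Sum>i. (t gchoose i) * (f - 1) ^ i)\<close> of a formal power series \<open>f\<close>.
  It is meaningful only if \<open>f\<close> has constant term 1; the composition with
  \<open>f - 1\<close> is then a legitimate substitution, and the result has constant term 1 as well.
\<close>

definition fps_binomial_power :: "'a::field_char_0 fps \<Rightarrow> 'a \<Rightarrow> 'a fps" where
  "fps_binomial_power f t = fps_binomial t oo (f - 1)"

text \<open>The factors are indexed from 0, so the factor for \<open>j \<ge> 1\<close> occurs at index \<open>j - 1\<close>.\<close>

definition p_factor :: "nat \<Rightarrow> rat \<Rightarrow> nat \<Rightarrow> rat fps" where
  "p_factor u t j =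
     fps_binomial_power ((1 - fps_X ^ Suc j) * (1 - fps_X ^ (u * Suc j))) t"

text \<open>
  The infinite product is taken with respect to the topology of coefficientwise
  stabilisation on \<^typ>\<open>rat fps\<close>; it converges by \<open>p_factor_has_prod\<close> below.
\<close>

definition p_gen :: "nat \<Rightarrow> rat \<Rightarrow> rat fps" where
  "p_gen u t = prodinf (p_factor u t)"

definition p_coeff :: "nat \<Rightarrow> rat \<Rightarrow> nat \<Rightarrow> rat" where
  "p_coeff u t n = fps_nth (p_gen u t) n"

text \<open>
  Divisibility of the numerator of the reduced fraction (\<^const>\<open>quotient_of\<close> yields the
  coprime representation with positive denominator).
\<close>

definition rat_cong_zero :: "rat \<Rightarrow> int \<Rightarrow> bool" where
  "rat_cong_zero x M \<longleftrightarrow> M dvd fst (quotient_of x)"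

lemma fps_power_nth_eq_0:
  fixes g :: "'a::comm_ring_1 fps"
  assumes "\<And>l. l \<le> i \<Longrightarrow> fps_nth g l = 0" "k \<le> i" "j > 0"
  shows "fps_nth (g ^ j) k = 0"
proof -
  obtain j' where "j = Suc j'" using assms(3) by (cases j) auto
  then show ?thesis using assms(1,2) by (simp add: fps_mult_nth)
qed

lemma fps_binomial_power_nth:
  assumes "\<And>l. l \<le> i \<Longrightarrow> fps_nth (f - 1) l = 0" "k \<le> i"
  shows "fps_nth (fps_binomial_power f t) k = (if k = 0 then 1 else 0)"
proof -
  have "fps_nth (fps_binomial_power f t) k = (\<Sum>j=0..k. (t gchoose j) * fps_nth ((f - 1) ^ j) k)"
    by (simp add: fps_binomial_power_def fps_compose_nth fps_binomial_nth)
  also have "\<dots> = (\<Sum>j\<in>{0}. (t gchoose j) * fps_nth ((f - 1) ^ j) k)"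
    by (rule sum.mono_neutral_right) (auto intro!: fps_power_nth_eq_0[OF assms])
  finally show ?thesis by simp
qed

lemma p_factor_nth:
  assumes "u > 0" "k \<le> j"
  shows "fps_nth (p_factor u t j) k = (if k = 0 then 1 else 0)"
  unfolding p_factor_def
proof (rule fps_binomial_power_nth[OF _ assms(2)])
  fix l assume l: "l \<le> j"
  let ?v = "u * Suc j"
  have v: "?v > j" using assms(1) by (cases u) auto
  have "(1 - fps_X ^ Suc j) * (1 - fps_X ^ ?v) - 1
      = fps_X ^ Suc j * (fps_X ^ ?v - 1) - (fps_X ^ ?v :: rat fps)"
    by (simp only: algebra_simps mult_1_left mult_1_right)
  moreover have "fps_nth (fps_X ^ Suc j * (fps_X ^ ?v - 1)) l = (0::rat)"
    using l by (simp only: fps_X_power_mult_nth) simp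
  moreover have "fps_nth (fps_X ^ ?v) l = (0::rat)"
    using l v by (simp only: fps_X_power_nth) simp
  ultimately show "fps_nth ((1 - fps_X ^ Suc j) * (1 - fps_X ^ ?v) - 1) l = (0::rat)"
    by (simp only: fps_sub_nth)
qed

lemma p_factor_has_prod:
  assumes "u > 0"
  shows "p_factor u t has_prod p_gen u t"
proof -
  let ?f = "p_factor u t"
  define L where "L = Abs_fps (\<lambda>n. fps_nth (\<Prod>i\<le>n. ?f i) n)"
  have keep: "fps_nth (G * ?f j) k = fps_nth G k" if "k \<le> j" for G j k
  proof -
    have "fps_nth (G * ?f j) k = (\<Sum>i=0..k. fps_nth G i * (if k - i = 0 then 1 else 0))"
      using that by (simp add: fps_mult_nth p_factor_nth[OF assms])
    also have "\<dots> = (\<Sum>i\<in>{k}. fps_nth G i * (if k - i = 0 then 1 else 0))"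
      by (rule sum.mono_neutral_right) auto
    finally show ?thesis by simp
  qed
  have stab: "fps_nth (\<Prod>i\<le>n. ?f i) k = fps_nth L k" if "k \<le> n" for n k
    using that
  proof (induction n rule: dec_induct)
    case base then show ?case by (simp add: L_def)
  next
    case (step n) then show ?case by (simp add: keep)
  qed
  have "(\<lambda>n. \<Prod>i\<le>n. ?f i) \<longlonglongrightarrow> L"
    by (rule tendsto_fpsI) (auto intro!: eventually_sequentiallyI stab)
  moreover have "fps_nth L 0 = 1" by (simp add: L_def p_factor_nth[OF assms])
  then have "L \<noteq> 0" by auto
  ultimately have "raw_has_prod ?f 0 L" by (simp add: raw_has_prod_def)
  then have "?f has_prod L" by (simp add: has_prod_def)
  then show ?thesis unfolding p_gen_def using has_prod_unique by metis
qed

end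

theory Submission
  imports Defs "HOL-Computational_Algebra.Formal_Laurent_Series"
begin

text \<open>
  Write \<open>F = \<Prod>\<^sub>j (1 - q\<^sup>j)(1 - q\<^bsup>uj\<^esup>)\<close> and \<open>N = k + m\<close>, so that the generating function is
  \<open>F\<^sup>2 X\<^sub>N\<close> with \<open>X\<^sub>N = F\<^bsup>-\<ell>^N/b\<^esup>\<close>. Since \<open>X\<^sub>N(q) \<equiv> X\<^bsub>N-1\<^esub>(q\<^sup>\<ell>)\<close> modulo \<open>\<ell>\<^sup>N\<close>, the coefficients
  of \<open>F\<^sup>2 X\<^sub>N\<close> along \<open>\<ell>n + \<rho>\<close> are governed by those of \<open>F\<^sup>2\<close>. Now \<open>F\<^sup>2\<close> is, up to a power of \<open>q\<close>,
  a theta series with complex multiplication by \<open>\<int>[\<i>]\<close> (\<open>u = 2\<close>, \<open>\<ell> = 3\<close>) or \<open>\<int>[\<omega>]\<close> (\<open>u = 3\<close>, \<open>\<ell> = 5\<close>),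
  in which \<open>\<ell>\<close> is inert; hence its coefficients along \<open>\<ell>n + \<rho>\<close> vanish except for those along
  \<open>\<ell>\<^sup>2n + \<ell>\<sigma> + \<rho>\<close>, which are \<open>-\<ell>\<close> times the original ones. Altogether the coefficients of \<open>F\<^sup>2 X\<^sub>N\<close>
  along \<open>\<ell>\<^sup>2n + \<ell>\<sigma> + \<rho>\<close> are \<open>-\<ell>\<close> times those of \<open>F\<^sup>2 X\<^bsub>N-2\<^esub>\<close> modulo \<open>\<ell>\<^sup>N\<close>, and one inducts on \<open>s\<close>.
\<close>

subsection \<open>Infinite products of formal power series\<close>

lemma fps_X_power_dvd_iff:
  fixes f :: "'a::comm_ring_1 fps"
  shows "fps_X ^ n dvd f \<longleftrightarrow> (\<forall>i<n. fps_nth f i = 0)"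
proof
  assume "fps_X ^ n dvd f"
  then obtain g where "f = fps_X ^ n * g" by (rule dvdE)
  then show "\<forall>i<n. fps_nth f i = 0" by (simp add: fps_X_power_mult_nth)
next
  assume "\<forall>i<n. fps_nth f i = 0"
  then have "f = fps_X ^ n * fps_shift n f"
    by (auto simp: fps_eq_iff fps_X_power_mult_nth)
  then show "fps_X ^ n dvd f" by (metis dvdI)
qed

text \<open>For a \<open>stabilising\<close> family the factors with index above n do not affect the
  coefficient of degree n, so this is the infinite product. Over every commutative ring, convergence
  becomes divisibility by powers of \<open>fps_X\<close>.\<close>

definition lprod :: "(nat \<Rightarrow> 'a::comm_ring_1 fps) \<Rightarrow> 'a fps" where
  "lprod f = Abs_fps (\<lambda>n. fps_nth (\<Prod>j<Suc n. f j) n)"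

definition stabilising :: "(nat \<Rightarrow> 'a::comm_ring_1 fps) \<Rightarrow> bool" where
  "stabilising f \<longleftrightarrow> (\<forall>j. fps_X ^ j dvd f j - 1)"

lemma lprodI:
  assumes "\<And>n. fps_X ^ n dvd L - (\<Prod>j<n. f j)"
  shows "lprod f = L"
proof (rule fps_ext)
  fix n
  show "fps_nth (lprod f) n = fps_nth L n"
    using assms[of "Suc n", unfolded fps_X_power_dvd_iff] by (simp add: lprod_def del: prod.lessThan_Suc)
qed

lemma dvd_lprod:
  assumes "stabilising f"
  shows "fps_X ^ n dvd lprod f - (\<Prod>j<n. f j)"
proof -
  \<comment> \<open>A new factor \<open>f m\<close> changes the partial product by a multiple of
    \<open>fps_X ^ m\<close> only.\<close>
  have step: "fps_nth (\<Prod>j<m. f j) i = fps_nth (\<Prod>j<Suc i. f j) i" if "Suc i \<le> m" for i m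
    using that
  proof (induction m rule: dec_induct)
    case (step m)
    have "(\<Prod>j<Suc m. f j) - (\<Prod>j<m. f j) = (\<Prod>j<m. f j) * (f m - 1)"
      by (simp add: algebra_simps)
    moreover have "fps_X ^ m dvd (\<Prod>j<m. f j) * (f m - 1)"
      using assms by (simp add: stabilising_def)
    ultimately have "fps_nth ((\<Prod>j<Suc m. f j) - (\<Prod>j<m. f j)) i = 0"
      using step.hyps by (metis fps_X_power_dvd_iff Suc_le_eq)
    with step.IH show ?case by simp
  qed simp
  show ?thesis
    unfolding fps_X_power_dvd_iff
    using step[of _ n] by (auto simp: lprod_def Suc_le_eq simp del: prod.lessThan_Suc)
qed

lemma dvd_mult_diff:
  fixes a :: "'a::comm_ring_1"
  assumes "d dvd a - b" "d dvd a' - b'"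
  shows "d dvd a * a' - b * b'"
proof -
  have "a * a' - b * b' = (a - b) * a' + b * (a' - b')" by (simp add: algebra_simps)
  then show ?thesis using assms by simp
qed

lemma dvd_power_diff:
  fixes a :: "'a::comm_ring_1"
  assumes "d dvd a - b"
  shows "d dvd a ^ n - b ^ n"
  using assms by (induction n) (auto intro: dvd_mult_diff)

lemma dvd_prod_diff:
  fixes f g :: "'i \<Rightarrow> 'a::comm_ring_1"
  assumes "\<And>i. i \<in> A \<Longrightarrow> d dvd f i - g i"
  shows "d dvd prod f A - prod g A"
  using assms by (induction A rule: infinite_finite_induct) (auto intro: dvd_mult_diff)

lemma stabilising_mult:
  assumes "stabilising f" "stabilising g"
  shows "stabilising (\<lambda>j. f j * g j)"
  unfolding stabilising_def
proof
  fix j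
  show "fps_X ^ j dvd f j * g j - 1"
    using dvd_mult_diff[of "fps_X ^ j" "f j" 1 "g j" 1] assms by (simp add: stabilising_def)
qed

lemma stabilising_power:
  assumes "stabilising f"
  shows "stabilising (\<lambda>j. f j ^ n)"
  unfolding stabilising_def
proof
  fix j
  show "fps_X ^ j dvd f j ^ n - 1"
    using dvd_power_diff[of "fps_X ^ j" "f j" 1 n] assms by (simp add: stabilising_def)
qed

lemma lprod_mult:
  assumes "stabilising f" "stabilising g"
  shows "lprod (\<lambda>j. f j * g j) = lprod f * lprod g"
proof (rule lprodI)
  fix n
  have "(\<Prod>j<n. f j * g j) = (\<Prod>j<n. f j) * (\<Prod>j<n. g j)" by (rule prod.distrib)
  then show "fps_X ^ n dvd lprod f * lprod g - (\<Prod>j<n. f j * g j)"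
    using dvd_mult_diff[OF dvd_lprod[OF assms(1)] dvd_lprod[OF assms(2)]] by metis
qed

lemma lprod_power:
  assumes "stabilising f"
  shows "lprod (\<lambda>j. f j ^ n) = lprod f ^ n"
proof (rule lprodI)
  fix m
  have "(\<Prod>j<m. f j ^ n) = (\<Prod>j<m. f j) ^ n" by (rule prod_power_distrib[symmetric])
  then show "fps_X ^ m dvd lprod f ^ n - (\<Prod>j<m. f j ^ n)"
    using dvd_power_diff[OF dvd_lprod[OF assms]] by metis
qed

lemma lprod_prod:
  assumes "\<And>t. t \<in> A \<Longrightarrow> stabilising (f t)"
  shows "lprod (\<lambda>j. \<Prod>t\<in>A. f t j) = (\<Prod>t\<in>A. lprod (f t))"
proof (rule lprodI)
  fix n
  have "(\<Prod>j<n. \<Prod>t\<in>A. f t j) = (\<Prod>t\<in>A. \<Prod>j<n. f t j)" by (rule prod.swap)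
  then show "fps_X ^ n dvd (\<Prod>t\<in>A. lprod (f t)) - (\<Prod>j<n. \<Prod>t\<in>A. f t j)"
    using assms by (auto intro!: dvd_prod_diff dvd_lprod)
qed

text \<open>The first n blocks are the first \<open>k * n\<close> factors, so the error is divisible
  by \<open>fps_X ^ (k * n)\<close>.\<close>

lemma lprod_block:
  assumes "stabilising f" "k > 0"
  shows "lprod (\<lambda>j. \<Prod>t<k. f (k * j + t)) = lprod f"
proof (rule lprodI)
  fix n
  have "(\<Prod>t<k. f (k * j + t)) = (\<Prod>i = j * k..<j * k + k. f i)" for j
    by (subst prod.atLeastLessThan_shift_0) (simp add: o_def lessThan_atLeast0 mult.commute)
  then have "(\<Prod>j<n. \<Prod>t<k. f (k * j + t)) = (\<Prod>j<k * n. f j)"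
    by (simp only: prod.nat_group mult.commute[of n k])
  moreover have "fps_X ^ n dvd (fps_X :: 'a fps) ^ (k * n)"
    using assms(2) by (intro le_imp_power_dvd) auto
  ultimately show "fps_X ^ n dvd lprod f - (\<Prod>j<n. \<Prod>t<k. f (k * j + t))"
    using dvd_lprod[OF assms(1)] dvd_trans by metis
qed

lemma lprod_Suc:
  assumes "stabilising f" "stabilising (\<lambda>j. f (Suc j))"
  shows "lprod f = f 0 * lprod (\<lambda>j. f (Suc j))"
proof (rule lprodI)
  fix n
  show "fps_X ^ n dvd f 0 * lprod (\<lambda>j. f (Suc j)) - (\<Prod>j<n. f j)"
  proof (cases n)
    case (Suc m)
    have "fps_X ^ n dvd f 0 * lprod (\<lambda>j. f (Suc j)) - f 0 * (\<Prod>j<n. f (Suc j))"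
      by (simp add: dvd_lprod[OF assms(2)] right_diff_distrib[symmetric])
    moreover have "f 0 * (\<Prod>j<n. f (Suc j)) - (\<Prod>j<n. f j) = (\<Prod>j<n. f j) * (f n - 1)"
      by (simp only: prod.lessThan_Suc_shift[symmetric] o_def prod.lessThan_Suc) (simp add: algebra_simps)
    moreover have "fps_X ^ n dvd (\<Prod>j<n. f j) * (f n - 1)"
      using assms(1) by (simp add: stabilising_def)
    ultimately show ?thesis
      by (metis (no_types, lifting) diff_add_cancel add_diff_eq dvd_add)
  qed simp
qed

lemma lprod_nth_0: "fps_nth (lprod f) 0 = fps_nth (f 0) 0"
  by (simp add: lprod_def)

lemma lprod_compose:
  fixes f :: "nat \<Rightarrow> 'a::idom fps"
  assumes "stabilising f" "k > 0"
  shows "(lprod f oo fps_X ^ k) = lprod (\<lambda>j. f j oo fps_X ^ k)"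
proof (rule lprodI[symmetric])
  fix n
  obtain g where g: "lprod f - (\<Prod>j<n. f j) = fps_X ^ n * g"
    using dvd_lprod[OF assms(1)] by (blast elim: dvdE)
  have X0: "fps_nth (fps_X ^ k :: 'a fps) 0 = 0" using assms(2) by simp
  have "(lprod f oo fps_X ^ k) - (\<Prod>j<n. (f j oo fps_X ^ k)) = (fps_X ^ n * g) oo fps_X ^ k"
    by (simp add: g[symmetric] fps_compose_sub_distrib fps_compose_prod_distrib[OF X0])
  also have "\<dots> = fps_X ^ (k * n) * (g oo fps_X ^ k)"
    by (simp add: fps_compose_mult_distrib[OF X0] fps_compose_power[OF X0, symmetric]
        fps_X_fps_compose_startby0[OF X0] power_mult)
  finally show "fps_X ^ n dvd (lprod f oo fps_X ^ k) - (\<Prod>j<n. (f j oo fps_X ^ k))"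
    using assms(2) le_imp_power_dvd[of n "k * n" "fps_X :: 'a fps"] by simp
qed

text \<open>The infinite q-Pochhammer symbol (-c q^r; q^m); \<open>c = - 1\<close> and
  \<open>r = m\<close> give Euler's product in q^m.\<close>

definition qprod :: "'a::comm_ring_1 \<Rightarrow> nat \<Rightarrow> nat \<Rightarrow> 'a fps" where
  "qprod c m r = lprod (\<lambda>j. 1 + fps_const c * fps_X ^ (m * j + r))"

lemma stabilising_qprod:
  "m > 0 \<Longrightarrow> stabilising (\<lambda>j. 1 + fps_const c * fps_X ^ (m * j + r))"
  unfolding stabilising_def
  by (auto intro!: dvd_mult le_imp_power_dvd trans_le_add1)

lemma qprod_nth_0: "r > 0 \<Longrightarrow> fps_nth (qprod c m r) 0 = 1"
  by (simp add: qprod_def lprod_nth_0)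

lemma qprod_nonzero: "r > 0 \<Longrightarrow> qprod c m r \<noteq> 0"
  using qprod_nth_0[of r c m] by auto

text \<open>The factor of index 0 is the constant \<open>1 + c\<close>. In particular the product
  vanishes for \<open>c = - 1\<close>.\<close>

lemma qprod_0:
  assumes "m > 0"
  shows "qprod c m 0 = fps_const (1 + c) * qprod c m m"
proof -
  have "stabilising (\<lambda>j. 1 + fps_const c * fps_X ^ (m * Suc j + 0))"
    using stabilising_qprod[OF assms, of c m] by (simp add: add.commute)
  from lprod_Suc[OF stabilising_qprod[OF assms, of c 0] this]
  show ?thesis
    by (simp add: qprod_def add.commute fps_const_add[symmetric] del: fps_const_add)
qed

lemma qprod_block:
  assumes "m > 0" "k > 0"
  shows "qprod c m r = (\<Prod>t<k. qprod c (k * m) (m * t + r))"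
proof -
  have "qprod c m r = lprod (\<lambda>j. \<Prod>t<k. 1 + fps_const c * fps_X ^ (m * (k * j + t) + r))"
    unfolding qprod_def by (rule lprod_block[symmetric, OF stabilising_qprod[OF assms(1)] assms(2)])
  also have "\<dots> = lprod (\<lambda>j. \<Prod>t<k. 1 + fps_const c * fps_X ^ (k * m * j + (m * t + r)))"
    by (simp add: algebra_simps)
  also have "\<dots> = (\<Prod>t<k. qprod c (k * m) (m * t + r))"
    unfolding qprod_def using assms by (intro lprod_prod stabilising_qprod) auto
  finally show ?thesis .
qed

lemma fps_const_minus_one: "fps_const (- 1) = - (1 :: 'a::comm_ring_1 fps)"
  by (simp add: fps_eq_iff)

lemma qprod_square:
  assumes "m > 0"
  shows "qprod (- 1) m r * qprod 1 m r = qprod (- 1) (2 * m) (2 * r)"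
proof -
  have eq: "(1 - fps_X ^ k) * (1 + fps_X ^ k) = (1 - fps_X ^ (2 * k) :: 'a fps)" for k
  proof -
    have "(1 - y) * (1 + y) = 1 - y * y" for y :: "'a fps" by (simp add: algebra_simps)
    then show ?thesis by (simp only: mult_2 power_add)
  qed
  show ?thesis
    unfolding qprod_def lprod_mult[symmetric, OF stabilising_qprod[OF assms] stabilising_qprod[OF assms]]
    by (simp add: fps_const_minus_one eq add_mult_distrib2 mult.assoc)
qed

text \<open>The elementary symmetric functions of 1, w, w^2 are 0, 0, 1, so the three factors for
  one exponent multiply to 1 + c^3 y^3.\<close>

lemma qprod_cube:
  assumes "m > 0" and w: "w\<^sup>2 + w + 1 = 0"
  shows "qprod c m r * qprod (w * c) m r * qprod (w\<^sup>2 * c) m r = qprod (c ^ 3) (3 * m) (3 * r)"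
proof -
  have eq: "(1 + fps_const c * y) * (1 + fps_const (w * c) * y) * (1 + fps_const (w\<^sup>2 * c) * y)
      = 1 + fps_const (c ^ 3) * y ^ 3" for y :: "'a fps"
  proof -
    define W C where "W = fps_const w" and "C = fps_const c"
    have W: "W\<^sup>2 + W + 1 = 0"
      using arg_cong[OF w, of fps_const] by (simp add: W_def fps_const_power)
    have "(1 + C * y) * (1 + W * C * y) * (1 + W\<^sup>2 * C * y) - (1 + C ^ 3 * y ^ 3)
        = (W\<^sup>2 + W + 1) * (C * y + W * C\<^sup>2 * y\<^sup>2 + (W - 1) * C ^ 3 * y ^ 3)"
      by (simp add: algebra_simps power2_eq_square power3_eq_cube)
    then have "(1 + C * y) * (1 + W * C * y) * (1 + W\<^sup>2 * C * y) = 1 + C ^ 3 * y ^ 3"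
      by (simp add: W)
    then show ?thesis
      by (simp add: W_def C_def fps_const_power)
  qed
  have exps: "(fps_X ^ (m * j + r)) ^ 3 = (fps_X ^ (3 * m * j + 3 * r) :: 'a fps)" for j
    by (simp only: power_mult[symmetric]) (simp add: algebra_simps)
  show ?thesis
    unfolding qprod_def
    by (subst lprod_mult[symmetric] | intro stabilising_mult stabilising_qprod assms)+
       (simp only: eq exps)
qed

text \<open>Euler's identity between partitions into distinct and into odd parts: split the product
  of all 1 - q^(m j) by parity, apply \<open>qprod_square\<close>, and cancel the even part.\<close>

lemma qprod_Euler:
  fixes m :: nat
  assumes "m > 0"
  shows "qprod (1::'a::idom) m m * qprod (- 1) (2 * m) m = 1"
proof -
  have "qprod (- 1 :: 'a) m m = qprod (- 1) (2 * m) m * qprod (- 1) (2 * m) (2 * m)"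
    using qprod_block[OF assms, of 2 "- 1::'a" m] by (simp add: numeral_2_eq_2)
  with qprod_square[OF assms, of m, where ?'a = 'a] have
    "(qprod (1::'a) m m * qprod (- 1) (2 * m) m) * qprod (- 1) (2 * m) (2 * m) = 1 * qprod (- 1) (2 * m) (2 * m)"
    by (simp add: algebra_simps)
  moreover have "qprod (- 1::'a) (2 * m) (2 * m) \<noteq> 0" using assms by (intro qprod_nonzero) auto
  ultimately show ?thesis using mult_right_cancel by blast
qed

subsection \<open>The Jacobi triple product\<close>

text \<open>Triangular numbers with integer argument. The terms a^(tri d) b^(tri(-d)) below are
  those of Ramanujan's general theta function f(a, b).\<close>

definition tri :: "int \<Rightarrow> nat" where
  "tri d = nat (d * (d + 1) div 2)"

lemma int_tri: "2 * int (tri d) = d * (d + 1)"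
proof -
  have "d * (d + 1) \<ge> 0"
    by (cases "d \<ge> 0") (auto simp: mult_nonpos_nonpos)
  moreover have "even (d * (d + 1))" by simp
  ultimately show ?thesis by (simp add: tri_def)
qed

lemma tri_0 [simp]: "tri 0 = 0"
  by (simp add: tri_def)

lemma tri_add_neg: "int (tri d + tri (- d)) = d\<^sup>2"
  using int_tri[of d] int_tri[of "- d"] by (simp add: algebra_simps power2_eq_square)

lemma tri_ge: "int (tri d) \<ge> \<bar>d\<bar> - 1"
proof -
  have "2 * (\<bar>d\<bar> - 1) \<le> d * (d + 1)"
  proof (cases "d \<ge> 0")
    case True
    then have "d * (d - 1) \<ge> 0" by (cases "d = 0") auto
    with True show ?thesis by (simp add: algebra_simps)
  next
    case False
    then have "(d + 1) * (d + 2) \<ge> 0" by (cases "d = - 1") (auto intro: mult_nonpos_nonpos)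
    with False show ?thesis by (simp add: algebra_simps)
  qed
  then have "2 * (\<bar>d\<bar> - 1) \<le> 2 * int (tri d)" by (simp only: int_tri)
  then show ?thesis by simp
qed

text \<open>Gaussian binomial coefficients by the q-Pascal rule, free of division. With an integer
  lower index they vanish outside \<open>0..n\<close>, so sums can be shifted without boundary
  terms.\<close>

fun gbinom :: "'a::comm_ring_1 \<Rightarrow> nat \<Rightarrow> int \<Rightarrow> 'a" where
  "gbinom q 0 j = (if j = 0 then 1 else 0)"
| "gbinom q (Suc n) j = gbinom q n j + q ^ nat (int n + 1 - j) * gbinom q n (j - 1)"

definition qfact :: "'a::comm_ring_1 \<Rightarrow> nat \<Rightarrow> 'a" where
  "qfact q n = (\<Prod>i<n. 1 - q ^ Suc i)"

lemma qfact_0 [simp]: "qfact q 0 = 1"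
  and qfact_Suc: "qfact q (Suc n) = qfact q n * (1 - q ^ Suc n)"
  by (simp_all add: qfact_def)

lemma gbinom_outside: "j < 0 \<or> j > int n \<Longrightarrow> gbinom q n j = 0"
  by (induction n arbitrary: j) auto

lemma gbinom_qfact:
  assumes "i + j = n"
  shows "gbinom q n (int i) * qfact q i * qfact q j = qfact q n"
  using assms
proof (induction n arbitrary: i j)
  case (Suc n)
  consider "i = 0" | "j = 0" | i' j' where "i = Suc i'" "j = Suc j'"
    by (cases i; cases j) auto
  then show ?case
  proof cases
    case 1
    with Suc.IH[of 0 n] Suc.prems show ?thesis
      by (simp add: qfact_Suc gbinom_outside mult.assoc[symmetric])
  next
    case 2
    with Suc.IH[of n 0] Suc.prems show ?thesis
      by (simp add: qfact_Suc gbinom_outside mult.assoc[symmetric])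
  next
    case 3
    have n: "n = i' + Suc j'" "n = Suc i' + j'" using Suc.prems 3 by auto
    have IH1: "gbinom q n (int i') * qfact q i' * qfact q (Suc j') = qfact q n"
      by (rule Suc.IH) (use n in auto)
    have IH2: "gbinom q n (int (Suc i')) * qfact q (Suc i') * qfact q j' = qfact q n"
      by (rule Suc.IH) (use n in auto)
    have g: "gbinom q (Suc n) (int i) = gbinom q n (int (Suc i')) + q ^ Suc j' * gbinom q n (int i')"
    proof -
      have "nat (int n + 1 - int i) = Suc j'" "int i - 1 = int i'" using 3 n by auto
      then show ?thesis using 3 by (simp only: gbinom.simps)
    qed
    have "gbinom q (Suc n) (int i) * qfact q i * qfact q j
      = (gbinom q n (int (Suc i')) * qfact q (Suc i') * qfact q j') * (1 - q ^ Suc j')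
        + q ^ Suc j' * (gbinom q n (int i') * qfact q i' * qfact q (Suc j')) * (1 - q ^ Suc i')"
      by (subst g) (simp only: 3 qfact_Suc algebra_simps)
    also have "\<dots> = qfact q n * (1 - q ^ (Suc j' + Suc i'))"
      unfolding IH1 IH2 power_add by (simp only: algebra_simps mult_1_left mult_1_right)
    also have "Suc j' + Suc i' = Suc n" using n by simp
    finally show ?thesis by (simp only: qfact_Suc)
  qed
qed simp

text \<open>The defining recursion is not symmetric; the symmetry is read off from the factorial
  formula by cancelling q-factorials.\<close>

lemma gbinom_sym:
  fixes q :: "'a::idom"
  assumes "\<And>n. qfact q n \<noteq> 0"
  shows "gbinom q n (int n - j) = gbinom q n j"
proof (cases "0 \<le> j \<and> j \<le> int n")
  case True
  then obtain i where j: "j = int i" using nonneg_int_cases by blast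
  with True obtain k where n: "n = i + k" using le_Suc_ex by auto
  have "gbinom q n (int i) * (qfact q i * qfact q k) = gbinom q n (int k) * (qfact q i * qfact q k)"
    using gbinom_qfact[of i k n q] gbinom_qfact[of k i n q] n by (simp add: algebra_simps)
  then show ?thesis using assms j n by simp
qed (auto simp: gbinom_outside)

text \<open>The q-Pascal rule splits each term. After a shift of d, the power of a b from the rule
  and the quotient t(d+1)/t(d) = a (a b)^d combine to a (a b)^p, independent of d. The weight g = 1
  gives the triple product, g = d the cube identity.\<close>

lemma triple_step:
  fixes a b :: "'a::comm_ring_1" and g :: "int \<Rightarrow> 'a"
  defines "t \<equiv> \<lambda>d. a ^ tri d * b ^ tri (- d)"
  shows "(\<Sum>d=- int s..int (Suc p). g d * gbinom (a * b) (Suc p + s) (int s + d) * t d)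
    = (\<Sum>d=- int s..int p. (g d + a * (a * b) ^ p * g (d + 1)) * gbinom (a * b) (p + s) (int s + d) * t d)"
proof -
  let ?G = "\<lambda>d. gbinom (a * b) (p + s) (int s + d)"
  have shift: "(a * b) ^ nat (int p - d) * t (d + 1) = a * (a * b) ^ p * t d" if "d \<le> int p" for d
  proof -
    have 1: "nat (int p - d) + tri (d + 1) = Suc p + tri d"
      using that int_tri[of "d + 1"] int_tri[of d] by (simp add: algebra_simps)
    have 2: "nat (int p - d) + tri (- (d + 1)) = p + tri (- d)"
      using that int_tri[of "- (d + 1)"] int_tri[of "- d"] by (simp add: algebra_simps)
    have "(a * b) ^ nat (int p - d) * t (d + 1)
        = a ^ (nat (int p - d) + tri (d + 1)) * b ^ (nat (int p - d) + tri (- (d + 1)))"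
      unfolding t_def power_add power_mult_distrib by (simp only: mult_ac)
    also have "\<dots> = a * (a * b) ^ p * t d"
      unfolding 1 2 t_def power_add power_mult_distrib power_Suc by (simp only: mult_ac)
    finally show ?thesis .
  qed
  have "(\<Sum>d=- int s..int (Suc p). g d * gbinom (a * b) (Suc p + s) (int s + d) * t d)
    = (\<Sum>d=- int s..int p + 1. g d * ?G d * t d)
      + (\<Sum>d=- int s..int p + 1. g d * (a * b) ^ nat (int p + 1 - d) * ?G (d - 1) * t d)"
    unfolding sum.distrib[symmetric]
    by (intro sum.cong) (auto simp: algebra_simps add_diff_eq)
  also have "(\<Sum>d=- int s..int p + 1. g d * ?G d * t d) = (\<Sum>d=- int s..int p. g d * ?G d * t d)"
    by (rule sum.mono_neutral_right) (auto simp: gbinom_outside)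
  also have "(\<Sum>d=- int s..int p + 1. g d * (a * b) ^ nat (int p + 1 - d) * ?G (d - 1) * t d)
    = (\<Sum>d=- int s + 1..int p + 1. g d * (a * b) ^ nat (int p + 1 - d) * ?G (d - 1) * t d)"
    by (rule sum.mono_neutral_right) (auto simp: gbinom_outside)
  also have "\<dots> = (\<Sum>d=- int s..int p. g (d + 1) * (a * b) ^ nat (int p - d) * ?G d * t (d + 1))"
    by (rule sum.reindex_bij_witness[of _ "\<lambda>d. d + 1" "\<lambda>d. d - 1"]) (auto simp: algebra_simps)
  also have "\<dots> = (\<Sum>d=- int s..int p. a * (a * b) ^ p * g (d + 1) * ?G d * t d)"
  proof (intro sum.cong refl)
    fix d assume "d \<in> {- int s..int p}"
    then have "g (d + 1) * ?G d * ((a * b) ^ nat (int p - d) * t (d + 1))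
        = g (d + 1) * ?G d * (a * (a * b) ^ p * t d)"
      using shift by simp
    then show "g (d + 1) * (a * b) ^ nat (int p - d) * ?G d * t (d + 1)
        = a * (a * b) ^ p * g (d + 1) * ?G d * t d"
      by (simp only: mult_ac)
  qed
  finally show ?thesis by (simp add: sum.distrib[symmetric] algebra_simps)
qed

lemma finite_triple_product_aux:
  fixes a b :: "'a::comm_ring_1"
  assumes "(\<Prod>k<s. 1 + b * (a * b) ^ k)
    = (\<Sum>d=- int s..0. gbinom (a * b) s (int s + d) * (a ^ tri d * b ^ tri (- d)))"
  shows "(\<Prod>k<p. 1 + a * (a * b) ^ k) * (\<Prod>k<s. 1 + b * (a * b) ^ k)
    = (\<Sum>d=- int s..int p. gbinom (a * b) (p + s) (int s + d) * (a ^ tri d * b ^ tri (- d)))"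
proof (induction p)
  case 0
  then show ?case using assms by simp
next
  case (Suc p)
  then show ?case
    using triple_step[where g = "\<lambda>_. 1" and a = a and b = b and s = s and p = p]
    by (simp add: sum_distrib_left[symmetric] mult.assoc) (simp add: algebra_simps)
qed

text \<open>The product over b alone is the case with a and b exchanged, reflected by the symmetry
  of the Gaussian binomials; the factors in a are then added one at a time.\<close>

lemma finite_triple_product:
  fixes a b :: "'a::idom"
  assumes "\<And>n. qfact (a * b) n \<noteq> 0"
  shows "(\<Prod>k<p. 1 + a * (a * b) ^ k) * (\<Prod>k<s. 1 + b * (a * b) ^ k)
    = (\<Sum>d=- int s..int p. gbinom (a * b) (p + s) (int s + d) * (a ^ tri d * b ^ tri (- d)))"
proof (rule finite_triple_product_aux)
  have "(\<Prod>k<s. 1 + b * (a * b) ^ k)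
      = (\<Sum>d=0..int s. gbinom (a * b) s d * (b ^ tri d * a ^ tri (- d)))"
    using finite_triple_product_aux[where s = 0 and p = s and a = b and b = a] by (simp add: mult.commute)
  also have "\<dots> = (\<Sum>d=- int s..0. gbinom (a * b) s (int s + d) * (a ^ tri d * b ^ tri (- d)))"
    using gbinom_sym[OF assms]
    by (intro sum.reindex_bij_witness[of _ uminus uminus]) (auto simp: mult.commute)
  finally show "(\<Prod>k<s. 1 + b * (a * b) ^ k) = \<dots>" .
qed

lemma neg_one_power_tri: "(- 1) ^ tri d * (- 1) ^ tri (- d) = ((- 1) ^ nat \<bar>d\<bar> :: 'a::comm_ring_1)"
proof -
  have "even (tri d + tri (- d)) \<longleftrightarrow> even (d\<^sup>2)"
    by (simp only: tri_add_neg[symmetric] even_of_nat)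
  also have "\<dots> \<longleftrightarrow> even (nat \<bar>d\<bar>)"
    by (simp add: even_nat_iff)
  finally show ?thesis
    by (subst power_add[symmetric]) (simp only: minus_one_power_iff)
qed

text \<open>The weight d imitates differentiating the triple product with a = z, b = q/z at z = -1.
  Weighted sums J and plain sums F satisfy J(p+1) = (1 - q^p) J(p) - q^p F(p).\<close>

lemma finite_Jacobi_cube:
  fixes q :: "'a::idom"
  assumes "\<And>n. qfact q n \<noteq> 0"
  shows "(\<Sum>d=- int s..int (Suc p). of_int d * gbinom q (Suc p + s) (int s + d)
           * ((- 1) ^ nat \<bar>d\<bar> * q ^ tri (- d))) = - qfact q p * qfact q s"
    (is "?J (Suc p) = _")
proof -
  let ?F = "\<lambda>p. \<Sum>d=- int s..int p. gbinom q (p + s) (int s + d) * ((- 1) ^ nat \<bar>d\<bar> * q ^ tri (- d))"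
  have t: "(- 1) ^ tri d * (- q) ^ tri (- d) = (- 1) ^ nat \<bar>d\<bar> * q ^ tri (- d)" for d
    unfolding power_minus[of q] mult.assoc[symmetric] neg_one_power_tri ..
  have F: "?F p = (\<Prod>k<p. 1 - q ^ k) * qfact q s" for p
    using finite_triple_product[of "- 1" "- q" p s] assms by (simp add: t qfact_def)
  have J: "?J (Suc p) = (1 - q ^ p) * ?J p - q ^ p * ?F p" for p
    using triple_step[where g = of_int and a = "- 1" and b = "- q" and s = s and p = p]
    by (simp add: t algebra_simps sum.distrib sum_distrib_left sum_subtractf)
  show ?thesis
  proof (induction p)
    case 0
    show ?case using J[of 0] F[of 0] by simp
  next
    case (Suc p)
    \<comment> \<open>The product formula contains the factor 1 - q^0.\<close>
    have "?F (Suc p) = 0" unfolding F by (simp add: prod.lessThan_Suc_shift del: prod.lessThan_Suc)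
    with J[of "Suc p"] Suc.IH show ?case by (simp add: qfact_Suc algebra_simps)
  qed
qed

subsection \<open>Theta series\<close>

text \<open>The formal series with terms A i q^(e i). Sums over infinite sets are 0, so it has this
  meaning only under \<open>finite_fibres\<close>.\<close>

definition gsum :: "('i \<Rightarrow> 'a::comm_ring_1) \<Rightarrow> ('i \<Rightarrow> nat) \<Rightarrow> 'a fps" where
  "gsum A e = Abs_fps (\<lambda>n. \<Sum>i\<in>{i. e i = n}. A i)"

definition finite_fibres :: "('i \<Rightarrow> nat) \<Rightarrow> bool" where
  "finite_fibres e \<longleftrightarrow> (\<forall>n. finite {i. e i = n})"

lemma gsum_nth: "fps_nth (gsum A e) n = (\<Sum>i\<in>{i. e i = n}. A i)"
  by (simp add: gsum_def)

lemma gsum_add: "gsum (\<lambda>i. A i + B i) e = gsum A e + gsum B e"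
  by (simp add: fps_eq_iff gsum_nth sum.distrib)

lemma gsum_cmult: "gsum (\<lambda>i. c * A i) e = fps_const c * gsum A e"
  by (simp add: fps_eq_iff gsum_nth sum_distrib_left)

lemma finite_fibres_le:
  assumes "finite_fibres e"
  shows "finite {i. e i \<le> n}"
proof -
  have "{i. e i \<le> n} = (\<Union>k\<in>{..n}. {i. e i = k})" by auto
  then show ?thesis using assms by (simp add: finite_fibres_def)
qed

lemma finite_fibres_add:
  assumes "finite_fibres e" "finite_fibres e'"
  shows "finite_fibres (\<lambda>(i, j). e i + e' j)"
  unfolding finite_fibres_def
proof
  fix n
  have "{x. (case x of (i, j) \<Rightarrow> e i + e' j) = n} \<subseteq> {i. e i \<le> n} \<times> {j. e' j \<le> n}" by auto
  then show "finite {x. (case x of (i, j) \<Rightarrow> e i + e' j) = n}"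
    by (rule finite_subset) (intro finite_cartesian_product finite_fibres_le assms)
qed

lemma gsum_mult:
  assumes "finite_fibres e" "finite_fibres e'"
  shows "gsum A e * gsum B e' = gsum (\<lambda>(i, j). A i * B j) (\<lambda>(i, j). e i + e' j)"
proof (rule fps_ext)
  fix n
  have fin: "finite {i. e i = k}" "finite {j. e' j = k}" for k
    using assms by (auto simp: finite_fibres_def)
  have "fps_nth (gsum A e * gsum B e') n
      = (\<Sum>k=0..n. \<Sum>(i, j)\<in>{i. e i = k} \<times> {j. e' j = n - k}. A i * B j)"
    by (simp add: fps_mult_nth gsum_nth sum_product sum.cartesian_product)
  also have "\<dots> = (\<Sum>(k, i, j)\<in>(SIGMA k:{0..n}. {i. e i = k} \<times> {j. e' j = n - k}). A i * B j)"
    by (rule sum.Sigma) (auto simp: fin)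
  also have "\<dots> = (\<Sum>(i, j)\<in>{(i, j). e i + e' j = n}. A i * B j)"
    by (rule sum.reindex_bij_witness[of _ "\<lambda>(i, j). (e i, i, j)" snd]) auto
  also have "{(i, j). e i + e' j = n} = {x. (case x of (i, j) \<Rightarrow> e i + e' j) = n}" by auto
  finally show "fps_nth (gsum A e * gsum B e') n
      = fps_nth (gsum (\<lambda>(i, j). A i * B j) (\<lambda>(i, j). e i + e' j)) n"
    by (simp add: gsum_nth)
qed

lemma gsum_split:
  assumes "finite_fibres e" "inj f" "inj g" "range f \<inter> range g = {}" "range f \<union> range g = UNIV"
  shows "gsum A e = gsum (A \<circ> f) (e \<circ> f) + gsum (A \<circ> g) (e \<circ> g)"
proof (rule fps_ext)
  fix n
  let ?F = "{i. e (f i) = n}" and ?G = "{i. e (g i) = n}"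
  have eq: "{i. e i = n} = f ` ?F \<union> g ` ?G"
  proof -
    have "i \<in> f ` ?F \<union> g ` ?G" if "e i = n" for i
    proof -
      have "i \<in> range f \<union> range g" using assms(5) by simp
      with that show ?thesis by auto
    qed
    then show ?thesis by auto
  qed
  have fin: "finite {i. e i = n}" using assms(1) by (simp add: finite_fibres_def)
  have "f ` ?F \<inter> g ` ?G = {}" using assms(4) by blast
  with fin have "(\<Sum>i\<in>{i. e i = n}. A i) = (\<Sum>i\<in>f ` ?F. A i) + (\<Sum>i\<in>g ` ?G. A i)"
    unfolding eq by (intro sum.union_disjoint) auto
  also have "\<dots> = (\<Sum>i\<in>?F. A (f i)) + (\<Sum>i\<in>?G. A (g i))"
    using assms(2,3) by (simp add: sum.reindex inj_on_subset[OF _ subset_UNIV])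
  finally show "fps_nth (gsum A e) n = fps_nth (gsum (A \<circ> f) (e \<circ> f) + gsum (A \<circ> g) (e \<circ> g)) n"
    by (simp add: gsum_nth)
qed

definition theta_exp :: "nat \<Rightarrow> nat \<Rightarrow> int \<Rightarrow> nat" where
  "theta_exp r s d = r * tri d + s * tri (- d)"

lemma int_theta_exp: "2 * int (theta_exp r s d) = int r * (d * (d + 1)) + int s * (d * (d - 1))"
proof -
  have "2 * int (theta_exp r s d) = int r * (2 * int (tri d)) + int s * (2 * int (tri (- d)))"
    by (simp add: theta_exp_def)
  then show ?thesis unfolding int_tri by (simp add: algebra_simps)
qed

lemma theta_exp_ge: "int (theta_exp r s d) \<ge> int (r + s) * (\<bar>d\<bar> - 1)"
proof -
  have "int r * (\<bar>d\<bar> - 1) \<le> int r * int (tri d)" "int s * (\<bar>d\<bar> - 1) \<le> int s * int (tri (- d))"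
    using tri_ge[of d] tri_ge[of "- d"] by (auto intro!: mult_left_mono)
  then show ?thesis by (simp add: theta_exp_def algebra_simps)
qed

lemma theta_exp_ge': "r + s > 0 \<Longrightarrow> \<bar>d\<bar> \<le> int (theta_exp r s d) + 1"
  using theta_exp_ge[of r s d] mult_right_mono[of 1 "int (r + s)" "\<bar>d\<bar> - 1"]
  by (cases "d = 0") auto

lemma finite_fibres_theta:
  assumes "r + s > 0"
  shows "finite_fibres (theta_exp r s)"
  unfolding finite_fibres_def
proof
  fix n
  have "{d. theta_exp r s d = n} \<subseteq> {- int n - 1..int n + 1}"
  proof
    fix d assume "d \<in> {d. theta_exp r s d = n}"
    with theta_exp_ge'[OF assms, of d] show "d \<in> {- int n - 1..int n + 1}" by auto
  qed
  then show "finite {d. theta_exp r s d = n}" using finite_subset by blast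
qed

section \<open>From finite to infinite triple products\<close>

lemma qfact_nth_0: "fps_nth (qfact (fps_X ^ m) n) 0 = (1 :: 'a::comm_ring_1)" if "m > 0"
  using that by (induction n) (simp_all add: qfact_Suc power_mult[symmetric])

lemma qfact_nonzero: "qfact (fps_X ^ m) n \<noteq> (0 :: 'a::comm_ring_1 fps)" if "m > 0"
  using qfact_nth_0[OF that, of n, where ?'a = 'a] by auto

lemma dvd_qfact_diff:
  fixes q :: "'a::comm_ring_1"
  assumes "k \<le> n"
  shows "q ^ Suc k dvd qfact q n - qfact q k"
  using assms
proof (induction n rule: dec_induct)
  case (step n)
  have "qfact q (Suc n) - qfact q k = (qfact q n - qfact q k) - q ^ Suc n * qfact q n"
    by (simp add: qfact_Suc algebra_simps)
  moreover have "q ^ Suc k dvd q ^ Suc n * qfact q n"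
    using step.hyps by (intro dvd_mult2 le_imp_power_dvd) auto
  ultimately show ?case using step.IH by (simp only: dvd_diff)
qed simp

text \<open>With Q = \<open>fps_X ^ m\<close> and k = n - |d|, all q-factorials of index at least k
  agree modulo Q^(k+1). In the factorial formula the indices n + d, n - d, n and 2 n are that large,
  and the q-factorials are units.\<close>

lemma dvd_qfact_gbinom:
  fixes d :: int
  assumes "m > 0" "\<bar>d\<bar> \<le> int n"
  shows "(fps_X ^ m) ^ Suc (n - nat \<bar>d\<bar>) dvd
    1 - qfact (fps_X ^ m) n * (gbinom (fps_X ^ m) (2 * n) (int n + d) :: 'a::field fps)"
    (is "?Q ^ _ dvd _")
proof -
  define i j k where "i = nat (int n + d)" and "j = nat (int n - d)" and "k = n - nat \<bar>d\<bar>"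
  have ij: "i + j = 2 * n" "int i = int n + d" and k: "k \<le> i" "k \<le> j" "k \<le> n" "k \<le> 2 * n"
    using assms(2) by (auto simp: i_def j_def k_def)
  let ?f = "qfact ?Q :: nat \<Rightarrow> 'a fps"
  have "?Q ^ Suc k dvd ?f i * ?f j - ?f k * ?f k" "?Q ^ Suc k dvd ?f n * ?f (2 * n) - ?f k * ?f k"
    using k by (auto intro!: dvd_mult_diff dvd_qfact_diff simp del: power_Suc)
  from dvd_diff[OF this] have "?Q ^ Suc k dvd ?f i * ?f j - ?f n * ?f (2 * n)" by simp
  also have "\<dots> = (1 - ?f n * gbinom ?Q (2 * n) (int n + d)) * (?f i * ?f j)"
    using gbinom_qfact[OF ij(1), of ?Q] by (simp add: ij(2) algebra_simps)
  finally have "?Q ^ Suc k dvd (1 - ?f n * gbinom ?Q (2 * n) (int n + d)) * (?f i * ?f j)" .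
  moreover have "is_unit (?f i * ?f j)"
    using assms(1) by (simp add: fps_is_unit_iff qfact_nth_0)
  ultimately show ?thesis by (simp add: k_def dvd_mult_unit_iff del: power_Suc)
qed

text \<open>Terms with |d| > n have exponent at least n. For the others the error starts in degree
  at least (r+s)(|d|-1) + (r+s)(n-|d|+1) = (r+s) n: the theta exponent offsets the loss of precision
  in the Gaussian binomial.\<close>

lemma theta_limit:
  fixes A :: "int \<Rightarrow> 'a::field"
  assumes "r + s > 0"
  shows "fps_X ^ n dvd gsum A (theta_exp r s) - (\<Sum>d=- int n..int n. fps_const (A d) *
     fps_X ^ theta_exp r s d * (qfact (fps_X ^ (r + s)) n * gbinom (fps_X ^ (r + s)) (2 * n) (int n + d)))"
proof -
  let ?e = "theta_exp r s" and ?Q = "fps_X ^ (r + s) :: 'a fps"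
  let ?S = "\<Sum>d=- int n..int n. fps_const (A d) * fps_X ^ ?e d"
  let ?c = "\<lambda>d. qfact ?Q n * gbinom ?Q (2 * n) (int n + d)"
  have "fps_nth (gsum A ?e) i = fps_nth ?S i" if "i < n" for i
  proof -
    have "{d. ?e d = i} \<subseteq> {- int n..int n}"
    proof
      fix d assume "d \<in> {d. ?e d = i}"
      with theta_exp_ge'[OF assms, of d] that show "d \<in> {- int n..int n}" by auto
    qed
    then have "(\<Sum>d\<in>{d. ?e d = i}. A d) = (\<Sum>d=- int n..int n. if ?e d = i then A d else 0)"
      by (simp add: sum.If_cases Int_absorb1)
    also have "\<dots> = fps_nth ?S i"
      unfolding fps_sum_nth by (intro sum.cong) (auto simp: fps_X_power_nth)
    finally show ?thesis by (simp add: gsum_nth)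
  qed
  then have 1: "fps_X ^ n dvd gsum A ?e - ?S" by (simp add: fps_X_power_dvd_iff)
  have 2: "fps_X ^ n dvd fps_X ^ ?e d * (1 - ?c d)" if "d \<in> {- int n..int n}" for d
  proof -
    have d: "\<bar>d\<bar> \<le> int n" using that by auto
    have "int n \<le> int (r + s) * int n" using assms mult_right_mono[of 1 "int (r + s)" "int n"] by linarith
    also have "\<dots> = int (r + s) * (\<bar>d\<bar> - 1) + int (r + s) * int (Suc (n - nat \<bar>d\<bar>))"
      using d by (simp add: of_nat_diff algebra_simps)
    also have "\<dots> \<le> int (?e d + (r + s) * Suc (n - nat \<bar>d\<bar>))"
      using theta_exp_ge[of r s d]
      by (simp only: of_nat_add[of "?e d"] of_nat_mult[of "r + s"] add_le_cancel_right)
    finally have "n \<le> ?e d + (r + s) * Suc (n - nat \<bar>d\<bar>)" by linarith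
    then have "fps_X ^ n dvd (fps_X ^ ?e d * ?Q ^ Suc (n - nat \<bar>d\<bar>))"
      by (simp add: power_add[symmetric] power_mult[symmetric] le_imp_power_dvd del: power_Suc)
    also have "\<dots> dvd fps_X ^ ?e d * (1 - ?c d)"
      using dvd_qfact_gbinom[OF assms d] by (rule mult_dvd_mono[OF dvd_refl])
    finally show ?thesis .
  qed
  have "fps_X ^ n dvd (\<Sum>d=- int n..int n. fps_const (A d) * (fps_X ^ ?e d * (1 - ?c d)))"
    by (intro dvd_sum dvd_mult[OF 2])
  also have "\<dots> = ?S - (\<Sum>d=- int n..int n. fps_const (A d) * fps_X ^ ?e d * ?c d)"
    by (simp add: algebra_simps sum_subtractf)
  finally have "fps_X ^ n dvd ?S - (\<Sum>d=- int n..int n. fps_const (A d) * fps_X ^ ?e d * ?c d)" .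
  from dvd_add[OF 1 this] show ?thesis by simp
qed

lemma power_int_tri:
  fixes c :: "'a::field"
  assumes "c \<noteq> 0"
  shows "c ^ tri d * inverse c ^ tri (- d) = c powi d"
proof -
  have "c ^ tri d * inverse c ^ tri (- d) = c powi (int (tri d) - int (tri (- d)))"
    using assms by (simp add: power_int_diff field_simps)
  moreover have "int (tri d) - int (tri (- d)) = d"
    using int_tri[of d] int_tri[of "- d"] by (simp add: algebra_simps)
  ultimately show ?thesis by simp
qed

text \<open>Limit of the finite form for a = c q^r and b = q^s / c with n factors of each kind,
  multiplied by the q-factorial in q^(r+s).\<close>

theorem Jacobi_triple_product:
  fixes c :: "'a::field"
  assumes "r + s > 0" "c \<noteq> 0"
  shows "gsum (\<lambda>d. c powi d) (theta_exp r s)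
    = qprod (- 1) (r + s) (r + s) * qprod c (r + s) r * qprod (inverse c) (r + s) s"
proof -
  let ?Q = "fps_X ^ (r + s) :: 'a fps"
  define a b where "a = fps_const c * fps_X ^ r" and "b = fps_const (inverse c) * fps_X ^ s"
  have ab: "a * b = ?Q"
  proof -
    have "a * b = fps_const (c * inverse c) * fps_X ^ (r + s)"
      unfolding a_def b_def power_add fps_const_mult[symmetric] by (simp only: mult_ac)
    then show ?thesis using assms(2) by simp
  qed
  have t: "a ^ tri d * b ^ tri (- d) = fps_const (c powi d) * fps_X ^ theta_exp r s d" for d
    unfolding a_def b_def theta_exp_def power_int_tri[OF assms(2), symmetric] power_add
      power_mult_distrib power_mult fps_const_power[symmetric] fps_const_mult[symmetric]
    by (simp only: mult_ac)
  let ?h = "\<lambda>j. (1 + fps_const (- 1) * fps_X ^ ((r + s) * j + (r + s))) *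
    (1 + fps_const c * fps_X ^ ((r + s) * j + r)) * (1 + fps_const (inverse c) * fps_X ^ ((r + s) * j + s))"
  have "lprod ?h = gsum (\<lambda>d. c powi d) (theta_exp r s)"
  proof (rule lprodI)
    fix n
    have f: "(\<Prod>j<n. 1 + fps_const (- 1) * fps_X ^ ((r + s) * j + (r + s))) = qfact ?Q n"
      unfolding qfact_def by (intro prod.cong refl)
        (simp add: fps_const_minus_one power_mult[symmetric] power_add[symmetric] algebra_simps)
    have exps: "fps_X ^ ((r + s) * j + t) = fps_X ^ t * ?Q ^ j" for j t
      unfolding power_add[of _ "(r + s) * j" t] power_mult by (rule mult.commute)
    have a: "(\<Prod>j<n. 1 + fps_const c * fps_X ^ ((r + s) * j + r)) = (\<Prod>j<n. 1 + a * ?Q ^ j)"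
      unfolding a_def exps by (simp only: mult.assoc)
    have b: "(\<Prod>j<n. 1 + fps_const (inverse c) * fps_X ^ ((r + s) * j + s)) = (\<Prod>j<n. 1 + b * ?Q ^ j)"
      unfolding b_def exps by (simp only: mult.assoc)
    have "(\<Prod>j<n. ?h j) = qfact ?Q n * ((\<Prod>j<n. 1 + a * ?Q ^ j) * (\<Prod>j<n. 1 + b * ?Q ^ j))"
      unfolding prod.distrib f a b by (simp only: mult.assoc)
    also have "\<dots> = (\<Sum>d=- int n..int n. fps_const (c powi d) *
      fps_X ^ theta_exp r s d * (qfact ?Q n * gbinom ?Q (2 * n) (int n + d)))"
      unfolding finite_triple_product[of a b n n, unfolded ab, OF qfact_nonzero[OF assms(1)]]
        sum_distrib_left t mult_2 by (intro sum.cong refl) (simp only: mult_ac)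
    finally show "fps_X ^ n dvd gsum (\<lambda>d. c powi d) (theta_exp r s) - (\<Prod>j<n. ?h j)"
      using theta_limit[OF assms(1), of n "\<lambda>d. c powi d"] by simp
  qed
  then show ?thesis
    unfolding qprod_def using assms(1)
    by (simp only: lprod_mult stabilising_mult stabilising_qprod)
qed

lemma Jacobi_cube_aux:
  assumes "m > 0"
  shows "gsum (\<lambda>d. of_int d * (- 1) ^ nat \<bar>d\<bar>) (theta_exp 0 m) = - (qprod (- 1 :: 'a::field) m m ^ 3)"
proof -
  let ?Q = "fps_X ^ m :: 'a fps"
  let ?h = "\<lambda>j. (1 + fps_const (- 1) * fps_X ^ (m * j + m)) ^ 3 :: 'a fps"
  have "lprod ?h = - gsum (\<lambda>d. of_int d * (- 1) ^ nat \<bar>d\<bar>) (theta_exp 0 m)"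
  proof (rule lprodI)
    fix n
    have f: "(\<Prod>j<n. 1 + fps_const (- 1 :: 'a) * fps_X ^ (m * j + m)) = qfact ?Q n"
      unfolding qfact_def by (intro prod.cong refl)
        (simp add: fps_const_minus_one power_mult[symmetric] power_add[symmetric] algebra_simps)
    have h: "(\<Prod>j<n. ?h j) = qfact ?Q n ^ 3" by (simp only: prod_power_distrib[symmetric] f)
    show "fps_X ^ n dvd - gsum (\<lambda>d. of_int d * (- 1) ^ nat \<bar>d\<bar>) (theta_exp 0 m) - (\<Prod>j<n. ?h j)"
    proof (cases n)
      case (Suc p)
      have "(\<Sum>d=- int n..int n. fps_const (of_int d * (- 1) ^ nat \<bar>d\<bar>) *
          fps_X ^ theta_exp 0 m d * (qfact ?Q n * gbinom ?Q (2 * n) (int n + d)))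
        = qfact ?Q n * (\<Sum>d=- int n..int (Suc p). of_int d * gbinom ?Q (Suc p + n) (int n + d)
           * ((- 1) ^ nat \<bar>d\<bar> * ?Q ^ tri (- d)))"
        unfolding sum_distrib_left mult_2 Suc
        by (intro sum.cong) (simp_all add: theta_exp_def power_mult fps_of_int[symmetric]
            fps_const_mult[symmetric] fps_const_power[symmetric] fps_const_minus_one mult_ac
            del: fps_const_mult fps_const_power gbinom.simps)
      also have "\<dots> = - (qfact ?Q n * (qfact ?Q p * qfact ?Q n))"
        unfolding finite_Jacobi_cube[OF qfact_nonzero[OF assms]] by simp
      finally have lim: "fps_X ^ n dvd gsum (\<lambda>d. of_int d * (- 1) ^ nat \<bar>d\<bar>) (theta_exp 0 m)
          + qfact ?Q n * (qfact ?Q p * qfact ?Q n)"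
        using theta_limit[of 0 m n "\<lambda>d. of_int d * (- 1 :: 'a) ^ nat \<bar>d\<bar>"] assms by simp
      \<comment> \<open>One of the three q-factorials has index p = n - 1; replacing it by index n
        costs a multiple of \<open>?Q ^ n\<close> only.\<close>
      have "?Q ^ n dvd qfact ?Q n - qfact ?Q p"
        unfolding Suc by (rule dvd_qfact_diff) simp
      then have "?Q ^ n dvd (qfact ?Q n - qfact ?Q p) * (qfact ?Q n * qfact ?Q n)" by simp
      moreover have "fps_X ^ n dvd ?Q ^ n"
        using assms by (simp add: power_mult[symmetric] le_imp_power_dvd)
      ultimately have "fps_X ^ n dvd (qfact ?Q n - qfact ?Q p) * (qfact ?Q n * qfact ?Q n)"
        using dvd_trans by blast
      with lim have "fps_X ^ n dvd (gsum (\<lambda>d. of_int d * (- 1) ^ nat \<bar>d\<bar>) (theta_exp 0 m)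
          + qfact ?Q n * (qfact ?Q p * qfact ?Q n)) + (qfact ?Q n - qfact ?Q p) * (qfact ?Q n * qfact ?Q n)"
        by (rule dvd_add)
      also have "\<dots> = - (- gsum (\<lambda>d. of_int d * (- 1) ^ nat \<bar>d\<bar>) (theta_exp 0 m) - qfact ?Q n ^ 3)"
        by (simp add: power3_eq_cube algebra_simps)
      finally show ?thesis unfolding h by (simp only: dvd_minus_iff)
    qed simp
  qed
  moreover have "lprod ?h = qprod (- 1) m m ^ 3"
    unfolding qprod_def by (rule lprod_power[OF stabilising_qprod[OF assms]])
  ultimately show ?thesis by (metis minus_minus)
qed

lemma neg_one_powi: "(- 1 :: 'a::field) powi d = (- 1) ^ nat \<bar>d\<bar>"
  by (simp add: power_int_def flip: power_inverse)

lemma alternating_theta: "m > 0 \<Longrightarrow> gsum (\<lambda>d. (- 1 :: 'a::field) powi d) (theta_exp 0 m) = 0"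
  using Jacobi_triple_product[of 0 m "- 1 :: 'a"] qprod_0[of m "- 1 :: 'a"] by simp

text \<open>The vanishing alternating theta series allows the weight d to be replaced by 2 d - 1,
  the coordinate that completes the square in d (d - 1). Substitutions that scale this coordinate
  then scale the weight too.\<close>

lemma Jacobi_cube:
  assumes "m > 0"
  shows "gsum (\<lambda>d. of_int (2 * d - 1) * (- 1 :: 'a::field) powi d) (theta_exp 0 m)
    = fps_const (- 2) * qprod (- 1) m m ^ 3"
proof -
  have "gsum (\<lambda>d. of_int (2 * d - 1) * (- 1 :: 'a) powi d) (theta_exp 0 m)
    = gsum (\<lambda>d. 2 * (of_int d * (- 1) powi d) + (- 1) * (- 1) powi d) (theta_exp 0 m)"
    by (simp add: algebra_simps)
  also have "\<dots> = fps_const 2 * (- (qprod (- 1) m m ^ 3))"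
    unfolding gsum_add gsum_cmult alternating_theta[OF assms]
    unfolding neg_one_powi Jacobi_cube_aux[OF assms] by simp
  also have "\<dots> = fps_const (- 2) * qprod (- 1) m m ^ 3"
    by (simp flip: fps_const_neg)
  finally show ?thesis .
qed

subsection \<open>Self-similarity of theta series with complex multiplication\<close>

text \<open>Coefficientwise ring homomorphism. It carries congruences of integer series to the
  rationals, and allows relations proved over a field to descend to the integers.\<close>

definition fps_of_int_coeffs :: "int fps \<Rightarrow> 'a::comm_ring_1 fps" where
  "fps_of_int_coeffs f = Abs_fps (\<lambda>n. of_int (fps_nth f n))"

lemma fps_of_int_coeffs_nth [simp]: "fps_nth (fps_of_int_coeffs f) n = of_int (fps_nth f n)"
  by (simp add: fps_of_int_coeffs_def)

lemma fps_of_int_coeffs_mult: "fps_of_int_coeffs (f * g) = fps_of_int_coeffs f * fps_of_int_coeffs g"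
  by (simp add: fps_eq_iff fps_mult_nth)

lemma fps_of_int_coeffs_1 [simp]: "fps_of_int_coeffs 1 = 1"
  by (simp add: fps_eq_iff)

lemma fps_of_int_coeffs_prod: "fps_of_int_coeffs (prod f A) = (\<Prod>i\<in>A. fps_of_int_coeffs (f i))"
  by (induction A rule: infinite_finite_induct) (simp_all add: fps_of_int_coeffs_mult)

lemma fps_of_int_coeffs_power: "fps_of_int_coeffs (f ^ n) = fps_of_int_coeffs f ^ n"
  by (induction n) (simp_all add: fps_of_int_coeffs_mult)

lemma fps_of_int_coeffs_qprod:
  "fps_of_int_coeffs (qprod (- 1) m r) = qprod (- 1 :: 'a::comm_ring_1) m r"
proof -
  have "fps_of_int_coeffs (1 + fps_const (- 1) * fps_X ^ k) = 1 + fps_const (- 1 :: 'a) * fps_X ^ k" for k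
    by (simp add: fps_eq_iff fps_const_minus_one fps_X_power_nth)
  then have "fps_of_int_coeffs (\<Prod>j<n. 1 + fps_const (- 1) * fps_X ^ (m * j + r))
      = (\<Prod>j<n. 1 + fps_const (- 1 :: 'a) * fps_X ^ (m * j + r))" for n
    by (simp add: fps_of_int_coeffs_prod)
  from arg_cong[OF this, of "\<lambda>f. fps_nth f _"] show ?thesis
    by (simp add: fps_eq_iff qprod_def lprod_def del: prod.lessThan_Suc)
qed

text \<open>Equivalently, the series of coefficients along \<open>l * k + \<rho>\<close> is -l
  q^\<sigma> f(q^l): a Hecke relation with eigenvalue 0.\<close>

definition self_similar :: "nat \<Rightarrow> nat \<Rightarrow> nat \<Rightarrow> 'a::comm_ring_1 fps \<Rightarrow> bool" where
  "self_similar l \<sigma> \<rho> f \<longleftrightarrow> (\<forall>n. fps_nth f (l * (l * n + \<sigma>) + \<rho>) = - of_nat l * fps_nth f n) \<and>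
     (\<forall>k. k mod l \<noteq> \<sigma> \<longrightarrow> fps_nth f (l * k + \<rho>) = 0)"

lemma self_similar_add:
  "self_similar l \<sigma> \<rho> f \<Longrightarrow> self_similar l \<sigma> \<rho> g \<Longrightarrow> self_similar l \<sigma> \<rho> (f + g)"
  by (simp add: self_similar_def algebra_simps)

lemma self_similar_const_mult:
  "self_similar l \<sigma> \<rho> f \<Longrightarrow> self_similar l \<sigma> \<rho> (fps_const c * f)"
  by (auto simp: self_similar_def algebra_simps)

lemma self_similar_of_int_coeffs:
  fixes c :: "'a::{idom, ring_char_0}"
  assumes "self_similar l \<sigma> \<rho> (fps_const c * fps_of_int_coeffs f)" "c \<noteq> 0"
  shows "self_similar l \<sigma> \<rho> f"
proof -
  have "of_int (fps_nth f (l * (l * n + \<sigma>) + \<rho>)) = (of_int (- int l * fps_nth f n) :: 'a)" for n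
  proof -
    have "c * of_int (fps_nth f (l * (l * n + \<sigma>) + \<rho>)) = c * (- of_nat l * of_int (fps_nth f n))"
      using assms(1) by (simp add: self_similar_def)
    then have "of_int (fps_nth f (l * (l * n + \<sigma>) + \<rho>)) = (- of_nat l * of_int (fps_nth f n) :: 'a)"
      using assms(2) mult_left_cancel by blast
    then show ?thesis by simp
  qed
  moreover have "fps_nth f (l * k + \<rho>) = 0" if "k mod l \<noteq> \<sigma>" for k
    using assms that by (simp add: self_similar_def)
  ultimately show ?thesis unfolding self_similar_def of_int_eq_iff by simp
qed

text \<open>S maps the fibre of e over n onto that over
  \<open>l * (l * n + \<sigma>) + \<rho>\<close>. Its range contains every index with exponent
  \<rho> modulo l, so the other fibres along \<open>l * k + \<rho>\<close> are empty.\<close>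

lemma self_similar_gsum:
  assumes "inj S" and A: "\<And>i. A (S i) = - of_nat l * A i"
    and e: "\<And>i. e (S i) = l * (l * e i + \<sigma>) + \<rho>"
    and range: "\<And>i. e i mod l = \<rho> \<Longrightarrow> i \<in> range S"
    and "\<sigma> < l" "\<rho> < l"
  shows "self_similar l \<sigma> \<rho> (gsum A e)"
  unfolding self_similar_def
proof (intro conjI allI impI)
  fix n
  have "{i. e i = l * (l * n + \<sigma>) + \<rho>} = S ` {i. e i = n}"
  proof -
    have "i \<in> S ` {i. e i = n}" if i: "e i = l * (l * n + \<sigma>) + \<rho>" for i
    proof -
      from i have "e i mod l = \<rho>" using \<open>\<rho> < l\<close> by simp
      then obtain i' where "i = S i'" using range by blast
      with i e[of i'] \<open>\<sigma> < l\<close> show ?thesis by auto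
    qed
    with e show ?thesis by auto
  qed
  then have "fps_nth (gsum A e) (l * (l * n + \<sigma>) + \<rho>) = (\<Sum>i\<in>{i. e i = n}. A (S i))"
    using \<open>inj S\<close> by (simp add: gsum_nth sum.reindex inj_on_subset[OF _ subset_UNIV])
  then show "fps_nth (gsum A e) (l * (l * n + \<sigma>) + \<rho>) = - of_nat l * fps_nth (gsum A e) n"
    by (simp add: A gsum_nth sum_distrib_left)
next
  fix k assume k: "k mod l \<noteq> \<sigma>"
  have "e i \<noteq> l * k + \<rho>" for i
  proof
    assume i: "e i = l * k + \<rho>"
    then have "e i mod l = \<rho>" using \<open>\<rho> < l\<close> by simp
    then obtain i' where "i = S i'" using range by blast
    with i e[of i'] \<open>\<sigma> < l\<close> have "k = l * e i' + \<sigma>" by auto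
    with k \<open>\<sigma> < l\<close> show False by simp
  qed
  then show "fps_nth (gsum A e) (l * k + \<rho>) = 0" by (simp add: gsum_nth)
qed

definition euler_pair :: "nat \<Rightarrow> 'a::comm_ring_1 fps" where
  "euler_pair u = qprod (- 1) 1 1 * qprod (- 1) u u"

lemma fps_of_int_coeffs_euler_pair: "fps_of_int_coeffs (euler_pair u) = euler_pair u"
  by (simp only: euler_pair_def fps_of_int_coeffs_mult fps_of_int_coeffs_qprod)

text \<open>Completing squares gives (2i)^2 + (2d-1)^2 = 0 modulo 3; as -1 is not a square modulo 3,
  both squares vanish. The proof checks the nine pairs of residues.\<close>

lemma residues_3:
  fixes i d :: int
  assumes "(i * i + d * d - d) mod 3 = 2"
  shows "i mod 3 = 0 \<and> d mod 3 = 2"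
proof -
  have "((i mod 3) * (i mod 3) + (d mod 3) * (d mod 3) - d mod 3) mod 3 = 2"
    unfolding assms[symmetric] by (intro mod_diff_cong mod_add_cong mod_mult_cong) simp_all
  moreover have "i mod 3 \<in> {0, 1, 2}" "d mod 3 \<in> {0, 1, 2}" by auto
  ultimately show ?thesis by auto
qed

text \<open>
  The form \<open>i\<^sup>2 + d\<^sup>2 - d\<close> is a norm form of \<open>\<int>[\<i>]\<close> up to completing squares, and 3 is inert
  there; the substitution below is multiplication by \<open>- 3\<close>.
\<close>

lemma self_similar_2_theta:
  "self_similar 3 0 2 (gsum (\<lambda>(i, d). (- 1) powi i * (of_int (2 * d - 1) * (- 1 :: 'a::field) powi d))
     (\<lambda>(i, d). theta_exp 1 1 i + theta_exp 0 2 d))"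
    (is "self_similar _ _ _ (gsum ?A ?e)")
proof (rule self_similar_gsum)
  let ?S = "\<lambda>(i :: int, d :: int). (- 3 * i, 2 - 3 * d)"
  have e: "int (?e (i, d)) = i * i + d * d - d" for i d
    using int_theta_exp[of 1 1 i] int_theta_exp[of 0 2 d] by (simp add: algebra_simps)
  show "inj ?S" by (auto simp: inj_def)
  show "?e (?S x) = 3 * (3 * ?e x + 0) + 2" for x
  proof (cases x)
    case (Pair i d)
    have "int (?e (- 3 * i, 2 - 3 * d)) = 9 * int (?e (i, d)) + 2"
      unfolding e by (simp add: algebra_simps)
    then show ?thesis unfolding Pair by simp
  qed
  show "x \<in> range ?S" if "?e x mod 3 = 2" for x
  proof (cases x)
    case (Pair i d)
    have "int (?e (i, d)) mod 3 = 2"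
      using arg_cong[OF that, of int] by (simp only: Pair zmod_int) simp
    then have "i mod 3 = 0 \<and> d mod 3 = 2" unfolding e by (rule residues_3)
    then have "i = - 3 * (- (i div 3))" "d = 2 - 3 * (- (d div 3))" by presburger+
    then have "x = ?S (- (i div 3), - (d div 3))" unfolding Pair by simp
    then show ?thesis by blast
  qed
  have "(- 1 :: 'a) powi (- 3 * i) = (- 1) powi i" "(- 1 :: 'a) powi (2 - 3 * d) = (- 1) powi d" for i d
    by (simp_all add: neg_one_powi minus_one_power_iff even_nat_iff)
  then show "?A (?S x) = - of_nat 3 * ?A x" for x
    by (cases x) (simp add: algebra_simps)
qed simp_all

text \<open>With E_m = \<open>qprod (- 1) m m\<close>, splitting E_1 by parity writes E_1^2 E_2^2 as
  the theta series of \<open>theta_exp 1 1\<close> times E_2^3, to which Jacobi's cube identity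
  applies. The constant -2 is cancelled over the rationals.\<close>

lemma self_similar_2: "self_similar 3 0 2 (euler_pair 2 ^ 2 :: int fps)"
proof (rule self_similar_of_int_coeffs)
  have "gsum (\<lambda>i. (- 1 :: rat) powi i) (theta_exp 1 1)
      = qprod (- 1) 2 2 * qprod (- 1) 2 1 * qprod (- 1) 2 1"
    using Jacobi_triple_product[of 1 1 "- 1 :: rat"] by (simp add: numeral_2_eq_2)
  moreover have "qprod (- 1 :: rat) 1 1 = qprod (- 1) 2 1 * qprod (- 1) 2 2"
    using qprod_block[of 1 2 "- 1 :: rat" 1] by (simp add: numeral_2_eq_2)
  ultimately have "fps_const (- 2) * fps_of_int_coeffs (euler_pair 2 ^ 2)
      = gsum (\<lambda>i. (- 1 :: rat) powi i) (theta_exp 1 1) * (fps_const (- 2) * qprod (- 1) 2 2 ^ 3)"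
    unfolding fps_of_int_coeffs_power fps_of_int_coeffs_euler_pair
    by (simp add: euler_pair_def power2_eq_square power3_eq_cube mult_ac)
  also have "\<dots> = gsum (\<lambda>(i, d). (- 1 :: rat) powi i * (of_int (2 * d - 1) * (- 1) powi d))
     (\<lambda>(i, d). theta_exp 1 1 i + theta_exp 0 2 d)"
    by (simp only: Jacobi_cube[symmetric] zero_less_numeral gsum_mult finite_fibres_theta
        add_pos_pos zero_less_one add_0)
  finally show "self_similar 3 0 2 (fps_const (- 2 :: rat) * fps_of_int_coeffs (euler_pair 2 ^ 2))"
    by (simp only: self_similar_2_theta)
qed simp

section \<open>Theta series twisted by a cube root of unity\<close>

lemma qprod_split_2: "m > 0 \<Longrightarrow> qprod c m m = qprod c (2 * m) m * qprod c (2 * m) (2 * m)"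
  using qprod_block[of m 2 c m] by (simp add: numeral_2_eq_2)

lemma qprod_split_3:
  "m > 0 \<Longrightarrow> qprod c m r = qprod c (3 * m) r * qprod c (3 * m) (m + r) * qprod c (3 * m) (2 * m + r)"
  using qprod_block[of m 3 c r] by (simp add: numeral_3_eq_3 mult_2 add_ac mult.assoc)

context
  fixes w :: "'a::field"
  assumes w: "w\<^sup>2 + w + 1 = 0"
begin

lemma cube_root_nonzero: "w \<noteq> 0"
  using w by auto

lemma cube_root_power_3: "w ^ 3 = 1"
proof -
  have "w ^ 3 - 1 = (w - 1) * (w\<^sup>2 + w + 1)" by (simp add: algebra_simps power2_eq_square power3_eq_cube)
  then show ?thesis unfolding w by simp
qed

lemma cube_root_inverse: "inverse w = w\<^sup>2"
  using cube_root_power_3 by (intro inverse_unique) (simp add: power2_eq_square power3_eq_cube mult.assoc)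

lemma cube_root_powi: "w powi (3 * k + n) = w powi n"
  using cube_root_nonzero cube_root_power_3
  by (simp add: power_int_add power_int_mult)

text \<open>Trades a twisted theta series for an untwisted one and E_3 for E_1. Both sides become
  products; \<open>qprod_cube\<close> completes the twisted factors and Euler's identity in q and
  q^3 removes the rest.\<close>

lemma gsum_cube_root_0:
  "qprod (- 1) 3 3 * gsum (\<lambda>d. w powi d) (theta_exp 1 1) = qprod (- 1) 1 1 * gsum (\<lambda>d. 1) (theta_exp 4 2)"
proof -
  define p P :: "nat \<Rightarrow> nat \<Rightarrow> 'a fps" where "p = qprod (- 1)" and "P = qprod 1"
  define W where "W = qprod w 2 1 * qprod (w\<^sup>2) 2 1"
  have split: "p 3 3 = p 6 3 * p 6 6" "p 1 1 = p 2 1 * p 2 2" "P 3 3 = P 6 3 * P 6 6" "P 1 1 = P 2 1 * P 2 2"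
    "P 2 2 = P 6 2 * P 6 4 * P 6 6"
    using qprod_split_2[of 3] qprod_split_2[of 1] qprod_split_3[of 2 1 2] by (simp_all add: p_def P_def)
  have W: "P 2 1 * W = P 6 3"
    using qprod_cube[of 2 w 1 1] w by (simp add: P_def W_def mult_ac)
  have E: "P 3 3 * p 6 3 = 1" "P 1 1 * p 2 1 = 1"
    using qprod_Euler[of 3] qprod_Euler[of 1] by (simp_all add: p_def P_def)
  have th: "gsum (\<lambda>d. w powi d) (theta_exp 1 1) = p 2 2 * W" "gsum (\<lambda>d. 1) (theta_exp 4 2) = p 6 6 * P 6 4 * P 6 2"
    using Jacobi_triple_product[of 1 1 w] Jacobi_triple_product[of 4 2 1] cube_root_nonzero
    by (simp_all add: cube_root_inverse p_def P_def W_def numeral_2_eq_2 mult_ac)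
  \<comment> \<open>After multiplication by \<open>P 2 1 * P 6 6\<close> both sides collapse to
    \<open>p 2 2 * p 6 6\<close>.\<close>
  have "(p 3 3 * (p 2 2 * W)) * (P 2 1 * P 6 6) = p 2 2 * p 6 6 * (P 6 3 * P 6 6 * p 6 3)"
    unfolding split(1) W[symmetric] by (simp only: mult_ac)
  also have "\<dots> = p 2 2 * p 6 6 * (P 2 1 * P 2 2 * p 2 1)"
    using E unfolding split(3,4) by simp
  also have "\<dots> = (p 1 1 * (p 6 6 * P 6 4 * P 6 2)) * (P 2 1 * P 6 6)"
    unfolding split(2,5) by (simp only: mult_ac)
  finally have "(p 3 3 * (p 2 2 * W)) * (P 2 1 * P 6 6) = (p 1 1 * (p 6 6 * P 6 4 * P 6 2)) * (P 2 1 * P 6 6)" .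
  moreover have "P 2 1 * P 6 6 \<noteq> 0" by (simp add: P_def qprod_nonzero)
  ultimately show ?thesis unfolding th p_def[symmetric] using mult_right_cancel by blast
qed

text \<open>As for \<open>gsum_cube_root_0\<close> with odd and even exponents exchanged; the
  exponent r = 0 yields the factor 1 + w.\<close>

lemma gsum_cube_root_1:
  "qprod (- 1) 3 3 * gsum (\<lambda>d. w powi d) (theta_exp 0 2)
    = fps_const (1 + w) * (qprod (- 1) 1 1 * gsum (\<lambda>d. 1) (theta_exp 5 1))"
proof -
  define p P :: "nat \<Rightarrow> nat \<Rightarrow> 'a fps" where "p = qprod (- 1)" and "P = qprod 1"
  define W where "W = qprod w 2 2 * qprod (w\<^sup>2) 2 2"
  have split: "p 3 3 = p 6 3 * p 6 6" "p 1 1 = p 2 1 * p 2 2" "P 3 3 = P 6 3 * P 6 6" "P 1 1 = P 2 1 * P 2 2"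
    "P 2 1 = P 6 1 * P 6 3 * P 6 5"
    using qprod_split_2[of 3] qprod_split_2[of 1] qprod_split_3[of 2 1 1] by (simp_all add: p_def P_def)
  have W: "P 2 2 * W = P 6 6"
    using qprod_cube[of 2 w 1 2] w by (simp add: P_def W_def mult_ac)
  have E: "P 3 3 * p 6 3 = 1" "P 1 1 * p 2 1 = 1"
    using qprod_Euler[of 3] qprod_Euler[of 1] by (simp_all add: p_def P_def)
  have th: "gsum (\<lambda>d. w powi d) (theta_exp 0 2) = fps_const (1 + w) * (p 2 2 * W)"
      "gsum (\<lambda>d. 1) (theta_exp 5 1) = p 6 6 * P 6 5 * P 6 1"
    using Jacobi_triple_product[of 0 2 w] Jacobi_triple_product[of 5 1 1] cube_root_nonzero qprod_0[of 2 w]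
    by (simp_all add: cube_root_inverse p_def P_def W_def numeral_2_eq_2 mult_ac)
  have "(p 3 3 * (p 2 2 * W)) * (P 2 2 * P 6 3) = p 2 2 * p 6 6 * (P 6 3 * P 6 6 * p 6 3)"
    unfolding split(1) W[symmetric] by (simp only: mult_ac)
  also have "\<dots> = p 2 2 * p 6 6 * (P 2 1 * P 2 2 * p 2 1)"
    using E unfolding split(3,4) by simp
  also have "\<dots> = (p 1 1 * (p 6 6 * P 6 5 * P 6 1)) * (P 2 2 * P 6 3)"
    unfolding split(2,5) by (simp only: mult_ac)
  finally have eq: "(p 3 3 * (p 2 2 * W)) * (P 2 2 * P 6 3) = (p 1 1 * (p 6 6 * P 6 5 * P 6 1)) * (P 2 2 * P 6 3)" .
  have "P 2 2 * P 6 3 \<noteq> 0" by (simp add: P_def qprod_nonzero)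
  with eq have "p 3 3 * (p 2 2 * W) = p 1 1 * (p 6 6 * P 6 5 * P 6 1)" using mult_right_cancel by blast
  then show ?thesis unfolding th p_def[symmetric] by (simp only: mult.left_commute)
qed

text \<open>The factors for -1, -w and -w^2 combine to the product in q^3; 1 - w comes from the
  exponent 0.\<close>

lemma gsum_minus_cube_root:
  "gsum (\<lambda>d. (- w) powi d) (theta_exp 0 1) = fps_const (1 - w) * qprod (- 1) 3 3"
  using Jacobi_triple_product[of 0 1 "- w"] cube_root_nonzero qprod_0[of 1 "- w"] qprod_cube[of 1 w "- 1" 1] w
  by (simp add: cube_root_inverse mult_ac)

text \<open>
  Splitting the product of the two theta series by the parity of \<open>i + j\<close> diagonalises
  the exponent. The second product in the first step is 0 and only serves to turn the weight
  into a function of \<open>i + j\<close>.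
\<close>

lemma cube_times_theta:
  "fps_const (- 2 * (1 - w)) * (qprod (- 1) 1 1 ^ 3 * qprod (- 1) 3 3)
    = gsum (\<lambda>d. w powi d) (theta_exp 1 1) * gsum (\<lambda>n. of_int (4 * n - 2) * w powi n) (theta_exp 0 2)
      - gsum (\<lambda>d. w powi d) (theta_exp 0 2) * gsum (\<lambda>n. of_int (4 * n) * w powi n) (theta_exp 1 1)"
proof -
  let ?e = "\<lambda>(i, j). theta_exp 0 1 i + theta_exp 0 1 j"
  let ?A = "\<lambda>(i, j). (of_int (2 * i - 1) * (- 1) powi i) * (- w) powi j + (- 1) powi i * (of_int (2 * j - 1) * (- w) powi j)"
  let ?f = "\<lambda>(l :: int, n :: int). (n - l, n + l)" and ?g = "\<lambda>(l :: int, n :: int). (n + 1 - l, n + l)"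
  have fib: "finite_fibres (theta_exp 0 1)" "finite_fibres (theta_exp 0 2)" "finite_fibres (theta_exp 1 1)"
    by (auto intro: finite_fibres_theta)
  have "fps_const (- 2 * (1 - w)) * (qprod (- 1) 1 1 ^ 3 * qprod (- 1) 3 3)
    = (fps_const (- 2) * qprod (- 1) 1 1 ^ 3) * (fps_const (1 - w) * qprod (- 1) 3 3)"
    unfolding fps_const_mult[symmetric] by (simp only: mult_ac)
  also have "\<dots> = gsum (\<lambda>i. of_int (2 * i - 1) * (- 1) powi i) (theta_exp 0 1) * gsum (\<lambda>j. (- w) powi j) (theta_exp 0 1)
      + gsum (\<lambda>i. (- 1) powi i) (theta_exp 0 1) * gsum (\<lambda>j. of_int (2 * j - 1) * (- w) powi j) (theta_exp 0 1)"
    unfolding alternating_theta[OF zero_less_one] Jacobi_cube[OF zero_less_one] gsum_minus_cube_root by simp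
  also have "\<dots> = gsum ?A ?e"
    unfolding gsum_mult[OF fib(1) fib(1)] gsum_add[symmetric] by (simp add: case_prod_unfold)
  also have "\<dots> = gsum (?A \<circ> ?f) (?e \<circ> ?f) + gsum (?A \<circ> ?g) (?e \<circ> ?g)"
  proof (rule gsum_split)
    show "finite_fibres ?e" by (rule finite_fibres_add[OF fib(1) fib(1)])
    show "inj ?f" "inj ?g" by (auto simp: inj_def)
    have "even (fst x + snd x)" if "x \<in> range ?f" for x using that by auto
    moreover have "odd (fst x + snd x)" if "x \<in> range ?g" for x using that by auto
    ultimately show "range ?f \<inter> range ?g = {}" by blast
    have "(i, j) \<in> range ?f \<union> range ?g" for i j
    proof (cases "even (i + j)")
      case True
      then have "(i, j) = ?f ((j - i) div 2, (i + j) div 2)" by auto presburger+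
      then show ?thesis by blast
    next
      case False
      then have "(i, j) = ?g ((j - i + 1) div 2, (i + j) div 2)" by auto presburger+
      then show ?thesis by blast
    qed
    then show "range ?f \<union> range ?g = UNIV" by auto
  qed
  also have "?e \<circ> ?f = (\<lambda>(l, n). theta_exp 1 1 l + theta_exp 0 2 n)"
  proof (rule ext, clarify)
    fix l n
    have "2 * int (theta_exp 0 1 (n - l) + theta_exp 0 1 (n + l)) = 2 * int (theta_exp 1 1 l + theta_exp 0 2 n)"
      unfolding of_nat_add distrib_left int_theta_exp by (simp add: algebra_simps)
    then show "(?e \<circ> ?f) (l, n) = theta_exp 1 1 l + theta_exp 0 2 n" by simp
  qed
  also have "?e \<circ> ?g = (\<lambda>(l, n). theta_exp 0 2 l + theta_exp 1 1 n)"
  proof (rule ext, clarify)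
    fix l n
    have "2 * int (theta_exp 0 1 (n + 1 - l) + theta_exp 0 1 (n + l)) = 2 * int (theta_exp 0 2 l + theta_exp 1 1 n)"
      unfolding of_nat_add distrib_left int_theta_exp by (simp add: algebra_simps)
    then show "(?e \<circ> ?g) (l, n) = theta_exp 0 2 l + theta_exp 1 1 n" by simp
  qed
  also have "?A \<circ> ?f = (\<lambda>(l, n). w powi l * (of_int (4 * n - 2) * w powi n))"
  proof (rule ext, clarify)
    fix l n
    have "(- 1 :: 'a) powi (n - l) * (- w) powi (n + l) = w powi l * w powi n"
      using cube_root_nonzero
      by (subst (2) mult_minus1[symmetric], subst power_int_mult_distrib)
         (simp add: power_int_add neg_one_powi minus_one_power_iff even_nat_iff)
    then show "(?A \<circ> ?f) (l, n) = w powi l * (of_int (4 * n - 2) * w powi n)"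
      by (simp add: algebra_simps)
  qed
  also have "?A \<circ> ?g = (\<lambda>(l, n). w powi l * (of_int (- 4 * n) * w powi n))"
  proof (rule ext, clarify)
    fix l n
    have "(- 1 :: 'a) powi (n + 1 - l) * (- w) powi (n + l) = - (w powi l * w powi n)"
      using cube_root_nonzero
      by (subst (2) mult_minus1[symmetric], subst power_int_mult_distrib)
         (simp add: power_int_add neg_one_powi minus_one_power_iff even_nat_iff)
    then show "(?A \<circ> ?g) (l, n) = w powi l * (of_int (- 4 * n) * w powi n)"
      by (simp add: algebra_simps)
  qed
  also have "gsum (\<lambda>(l, n). w powi l * (of_int (- 4 * n) * w powi n)) (\<lambda>(l, n). theta_exp 0 2 l + theta_exp 1 1 n)
    = - (gsum (\<lambda>d. w powi d) (theta_exp 0 2) * gsum (\<lambda>n. of_int (4 * n) * w powi n) (theta_exp 1 1))"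
    unfolding gsum_mult[OF fib(2,3)] by (simp add: fps_eq_iff gsum_nth case_prod_unfold sum_negf)
  also have "gsum (\<lambda>(l, n). w powi l * (of_int (4 * n - 2) * w powi n)) (\<lambda>(l, n). theta_exp 1 1 l + theta_exp 0 2 n)
    = gsum (\<lambda>d. w powi d) (theta_exp 1 1) * gsum (\<lambda>n. of_int (4 * n - 2) * w powi n) (theta_exp 0 2)"
    by (rule gsum_mult[OF fib(3,2), symmetric])
  finally show ?thesis by simp
qed

text \<open>Multiplied by E_1, the left side contains E_1^3 E_3, which
  \<open>cube_times_theta\<close> expands. The remaining E_3 is absorbed by the unweighted twisted
  theta series, each returning a factor E_1 that cancels; only the twist in n is left.\<close>

lemma euler_pair_3_theta:
  "fps_const (- 2 * (1 - w)) * euler_pair 3 ^ 2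
    = gsum (\<lambda>(j, n). of_int (4 * n - 2) * w powi n) (\<lambda>(j, n). theta_exp 4 2 j + theta_exp 0 2 n)
      + fps_const (- (1 + w)) * gsum (\<lambda>(j, n). of_int (4 * n) * w powi n) (\<lambda>(j, n). theta_exp 5 1 j + theta_exp 1 1 n)"
    (is "?l = ?r")
proof -
  define E1 E3 :: "'a fps" where "E1 = qprod (- 1) 1 1" and "E3 = qprod (- 1) 3 3"
  let ?h0 = "gsum (\<lambda>d. w powi d) (theta_exp 1 1)" and ?h1 = "gsum (\<lambda>d. w powi d) (theta_exp 0 2)"
  let ?k0 = "gsum (\<lambda>d. 1 :: 'a) (theta_exp 4 2)" and ?k1 = "gsum (\<lambda>d. 1 :: 'a) (theta_exp 5 1)"
  let ?a = "gsum (\<lambda>n. of_int (4 * n - 2) * w powi n) (theta_exp 0 2)"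
  let ?b = "gsum (\<lambda>n. of_int (4 * n) * w powi n) (theta_exp 1 1)"
  have "E1 * ?l = E3 * (fps_const (- 2 * (1 - w)) * (E1 ^ 3 * E3))"
    by (simp add: E1_def E3_def euler_pair_def power2_eq_square power3_eq_cube mult_ac)
  also have "\<dots> = (E3 * ?h0) * ?a - (E3 * ?h1) * ?b"
    unfolding E1_def E3_def cube_times_theta by (simp only: right_diff_distrib mult.assoc)
  also have "\<dots> = E1 * (?k0 * ?a + fps_const (- (1 + w)) * (?k1 * ?b))"
    unfolding E1_def E3_def gsum_cube_root_0 gsum_cube_root_1 fps_const_neg[symmetric]
    by (simp only: algebra_simps mult_minus_left mult_minus_right diff_conv_add_uminus)
  also have "?k0 * ?a + fps_const (- (1 + w)) * (?k1 * ?b) = ?r"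
    by (simp add: gsum_mult[OF finite_fibres_theta finite_fibres_theta])
  finally have eq: "E1 * ?l = E1 * ?r" .
  have "E1 \<noteq> 0" by (simp add: E1_def qprod_nonzero)
  from iffD1[OF mult_left_cancel[OF this] eq] show ?thesis .
qed

end

text \<open>The exponents times 12 and 3 are (6j+1)^2 + 3(2n-1)^2 - 4 and (3j+1)^2 + 3n^2 - 1. At
  residue 3 the forms vanish modulo 5, and -3 is not a square modulo 5, so each square
  vanishes.\<close>

lemma residues_5:
  fixes j n :: int
  shows "(3 * (j * j) + j + n * n - n) mod 5 = 3 \<Longrightarrow> j mod 5 = 4 \<and> n mod 5 = 3"
    and "(3 * (j * j) + 2 * j + n * n) mod 5 = 3 \<Longrightarrow> j mod 5 = 3 \<and> n mod 5 = 0"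
proof -
  define x y where "x = j mod 5" and "y = n mod 5"
  have "x \<in> {0, 1, 2, 3, 4}" "y \<in> {0, 1, 2, 3, 4}" unfolding x_def y_def by auto
  moreover have "(3 * (x * x) + x + y * y - y) mod 5 = (3 * (j * j) + j + n * n - n) mod 5"
    "(3 * (x * x) + 2 * x + y * y) mod 5 = (3 * (j * j) + 2 * j + n * n) mod 5"
    unfolding x_def y_def by (intro mod_diff_cong mod_add_cong mod_mult_cong; simp)+
  ultimately show "(3 * (j * j) + j + n * n - n) mod 5 = 3 \<Longrightarrow> j mod 5 = 4 \<and> n mod 5 = 3"
    and "(3 * (j * j) + 2 * j + n * n) mod 5 = 3 \<Longrightarrow> j mod 5 = 3 \<and> n mod 5 = 0"
    unfolding x_def[symmetric] y_def[symmetric] by auto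
qed

text \<open>
  As for \<open>self_similar_2_theta\<close>: the substitutions are multiplication by \<open>- 5\<close> in \<open>\<int>[\<omega>]\<close>,
  where 5 is inert.
\<close>

lemma self_similar_3_theta:
  fixes w :: "'a::field"
  assumes w: "w\<^sup>2 + w + 1 = 0"
  shows "self_similar 5 1 3 (gsum (\<lambda>(j, n). of_int (4 * n - 2) * w powi n) (\<lambda>(j, n). theta_exp 4 2 j + theta_exp 0 2 n))"
      (is "self_similar _ _ _ (gsum ?A ?e)")
    and "self_similar 5 1 3 (gsum (\<lambda>(j, n). of_int (4 * n) * w powi n) (\<lambda>(j, n). theta_exp 5 1 j + theta_exp 1 1 n))"
      (is "self_similar _ _ _ (gsum ?A' ?e')")
proof -
  show "self_similar 5 1 3 (gsum ?A ?e)"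
  proof (rule self_similar_gsum)
    let ?S = "\<lambda>(j :: int, n :: int). (- 5 * j - 1, 3 - 5 * n)"
    have e: "int (?e (j, n)) = 3 * (j * j) + j + n * n - n" for j n
      using int_theta_exp[of 4 2 j] int_theta_exp[of 0 2 n] by (simp add: algebra_simps)
    show "inj ?S" by (auto simp: inj_def)
    show "?e (?S x) = 5 * (5 * ?e x + 1) + 3" for x
    proof (cases x)
      case (Pair j n)
      have "int (?e (- 5 * j - 1, 3 - 5 * n)) = 25 * int (?e (j, n)) + 8"
        unfolding e by (simp add: algebra_simps)
      then show ?thesis unfolding Pair by simp
    qed
    show "x \<in> range ?S" if "?e x mod 5 = 3" for x
    proof (cases x)
      case (Pair j n)
      have "int (?e (j, n)) mod 5 = 3"
        using arg_cong[OF that, of int] by (simp only: Pair zmod_int) simp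
      then have "j mod 5 = 4 \<and> n mod 5 = 3" unfolding e by (rule residues_5)
      then have "j = - 5 * (- (j div 5) - 1) - 1" "n = 3 - 5 * (- (n div 5))" by presburger+
      then have "x = ?S (- (j div 5) - 1, - (n div 5))" unfolding Pair by simp
      then show ?thesis by blast
    qed
    have "w powi (3 - 5 * n) = w powi n" for n
      using cube_root_powi[OF w, of "1 - 2 * n" n] by simp
    then show "?A (?S x) = - of_nat 5 * ?A x" for x
      by (cases x) (simp add: algebra_simps)
  qed simp_all
  show "self_similar 5 1 3 (gsum ?A' ?e')"
  proof (rule self_similar_gsum)
    let ?S = "\<lambda>(j :: int, n :: int). (- 5 * j - 2, - 5 * n)"
    have e: "int (?e' (j, n)) = 3 * (j * j) + 2 * j + n * n" for j n
      using int_theta_exp[of 5 1 j] int_theta_exp[of 1 1 n] by (simp add: algebra_simps)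
    show "inj ?S" by (auto simp: inj_def)
    show "?e' (?S x) = 5 * (5 * ?e' x + 1) + 3" for x
    proof (cases x)
      case (Pair j n)
      have "int (?e' (- 5 * j - 2, - 5 * n)) = 25 * int (?e' (j, n)) + 8"
        unfolding e by (simp add: algebra_simps)
      then show ?thesis unfolding Pair by simp
    qed
    show "x \<in> range ?S" if "?e' x mod 5 = 3" for x
    proof (cases x)
      case (Pair j n)
      have "int (?e' (j, n)) mod 5 = 3"
        using arg_cong[OF that, of int] by (simp only: Pair zmod_int) simp
      then have "j mod 5 = 3 \<and> n mod 5 = 0" unfolding e by (rule residues_5)
      then have "j = - 5 * (- (j div 5) - 1) - 2" "n = - 5 * (- (n div 5))" by presburger+
      then have "x = ?S (- (j div 5) - 1, - (n div 5))" unfolding Pair by simp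
      then show ?thesis by blast
    qed
    have "w powi (- 5 * n) = w powi n" for n
      using cube_root_powi[OF w, of "- 2 * n" n] by simp
    then show "?A' (?S x) = - of_nat 5 * ?A' x" for x
      by (cases x) (simp add: algebra_simps)
  qed simp_all
qed

lemma self_similar_3: "self_similar 5 1 3 (euler_pair 3 ^ 2 :: int fps)"
proof (rule self_similar_of_int_coeffs)
  define w where "w = Complex (- 1 / 2) (sqrt 3 / 2)"
  have w: "w\<^sup>2 + w + 1 = 0"
    by (simp add: w_def complex_eq_iff power2_eq_square)
  have "w \<noteq> 1" by (simp add: w_def complex_eq_iff)
  then show "- 2 * (1 - w) \<noteq> 0" by simp
  have "fps_of_int_coeffs (euler_pair 3 ^ 2) = (euler_pair 3 ^ 2 :: complex fps)"
    by (simp only: fps_of_int_coeffs_power fps_of_int_coeffs_euler_pair)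
  then show "self_similar 5 1 3 (fps_const (- 2 * (1 - w)) * fps_of_int_coeffs (euler_pair 3 ^ 2))"
    by (simp only: euler_pair_3_theta[OF w] self_similar_add self_similar_const_mult self_similar_3_theta[OF w])
qed

subsection \<open>Rational numbers and power series modulo prime powers\<close>

text \<open>For \<open>l\<close> prime, \<open>vge l e x\<close> says that the \<open>l\<close>-adic valuation of \<open>x\<close> is at least \<open>e\<close>.\<close>

definition vge :: "nat \<Rightarrow> nat \<Rightarrow> rat \<Rightarrow> bool" where
  "vge l e x \<longleftrightarrow> (\<exists>a d :: int. coprime d (int l) \<and> x * of_int d = of_int (int l ^ e * a))"

lemma vge_of_int: "int l ^ e dvd a \<Longrightarrow> vge l e (of_int a)"
  unfolding vge_def by (elim dvdE) (intro exI[of _ 1] exI, auto)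

lemma vge_0 [simp]: "vge l e 0"
  using vge_of_int[of l e 0] by simp

lemma vge_add:
  assumes "vge l e x" "vge l e y"
  shows "vge l e (x + y)"
proof -
  obtain a d a' d' :: int where *: "coprime d (int l)" "x * of_int d = of_int (int l ^ e * a)"
    "coprime d' (int l)" "y * of_int d' = of_int (int l ^ e * a')"
    using assms by (auto simp: vge_def)
  have "(x + y) * of_int (d * d') = (x * of_int d) * of_int d' + (y * of_int d') * of_int d"
    by (simp add: algebra_simps)
  also have "\<dots> = of_int (int l ^ e * (a * d' + a' * d))"
    unfolding * by (simp add: algebra_simps)
  finally show ?thesis unfolding vge_def using *(1,3) by (metis coprime_mult_left_iff)
qed

lemma vge_mult:
  assumes "vge l e x" "vge l e' y"
  shows "vge l (e + e') (x * y)"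
proof -
  obtain a d a' d' :: int where *: "coprime d (int l)" "x * of_int d = of_int (int l ^ e * a)"
    "coprime d' (int l)" "y * of_int d' = of_int (int l ^ e' * a')"
    using assms by (auto simp: vge_def)
  have "(x * y) * of_int (d * d') = (x * of_int d) * (y * of_int d')"
    by (simp add: algebra_simps)
  also have "\<dots> = of_int (int l ^ (e + e') * (a * a'))"
    unfolding * by (simp add: power_add algebra_simps)
  finally show ?thesis unfolding vge_def using *(1,3) by (metis coprime_mult_left_iff)
qed

lemma vge_mono: "vge l e x \<Longrightarrow> e' \<le> e \<Longrightarrow> vge l e' x"
  unfolding vge_def by (metis le_add_diff_inverse mult.assoc power_add)

lemma vge_minus: "vge l e x \<Longrightarrow> vge l e (- x)"
  using vge_mult[OF vge_of_int[of l 0 "- 1"]] by force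

lemma vge_diff: "vge l e x \<Longrightarrow> vge l e y \<Longrightarrow> vge l e (x - y)"
  using vge_add[OF _ vge_minus] by force

lemma vge_sum: "(\<And>i. i \<in> A \<Longrightarrow> vge l e (f i)) \<Longrightarrow> vge l e (sum f A)"
  by (induction A rule: infinite_finite_induct) (auto intro: vge_add)

lemma vge_cancel:
  assumes "vge l e (x * of_int b)" "coprime b (int l)"
  shows "vge l e x"
proof -
  obtain a d :: int where *: "coprime d (int l)" "x * of_int b * of_int d = of_int (int l ^ e * a)"
    using assms(1) by (auto simp: vge_def)
  then have "x * of_int (b * d) = of_int (int l ^ e * a)" by (simp add: mult.assoc)
  with *(1) assms(2) show ?thesis unfolding vge_def by (metis coprime_mult_left_iff)
qed

lemma rat_cong_zero_if_vge:
  assumes "vge l e x"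
  shows "rat_cong_zero x (int l ^ e)"
proof -
  obtain p q where pq: "quotient_of x = (p, q)" by force
  then have q: "q > 0" and x: "x = of_int p / of_int q"
    using quotient_of_denom_pos quotient_of_div by auto
  obtain a d :: int where *: "coprime d (int l)" "x * of_int d = of_int (int l ^ e * a)"
    using assms by (auto simp: vge_def)
  from *(2) q have "of_int (p * d) = (of_int (int l ^ e * a * q) :: rat)"
    unfolding x by (simp add: field_simps)
  then have "p * d = int l ^ e * a * q" by (simp only: of_int_eq_iff)
  then have "int l ^ e dvd p * d" by simp
  then have "int l ^ e dvd p"
    using *(1) by (simp add: coprime_commute coprime_dvd_mult_left_iff)
  then show ?thesis by (simp add: rat_cong_zero_def pq)
qed

definition fps_vge :: "nat \<Rightarrow> nat \<Rightarrow> rat fps \<Rightarrow> bool" where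
  "fps_vge l e f \<longleftrightarrow> (\<forall>n. vge l e (fps_nth f n))"

lemma fps_vge_diff: "fps_vge l e f \<Longrightarrow> fps_vge l e g \<Longrightarrow> fps_vge l e (f - g)"
  by (simp add: fps_vge_def vge_diff)

lemma fps_vge_mult: "fps_vge l e f \<Longrightarrow> fps_vge l e' g \<Longrightarrow> fps_vge l (e + e') (f * g)"
  by (auto simp: fps_vge_def fps_mult_nth intro!: vge_sum vge_mult)

lemma fps_vge_1: "fps_vge l 0 1"
  by (auto simp: fps_vge_def intro: vge_of_int[of l 0 1, simplified])

lemma fps_vge_power: "fps_vge l 0 f \<Longrightarrow> fps_vge l 0 (f ^ n)"
  using fps_vge_mult[of l 0 f 0] by (induction n) (auto simp: fps_vge_1)

lemma fps_vge_sum: "(\<And>i. i \<in> A \<Longrightarrow> fps_vge l e (f i)) \<Longrightarrow> fps_vge l e (sum f A)"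
  by (simp add: fps_vge_def fps_sum_nth vge_sum)

lemma fps_vge_of_int_coeffs: "fps_vge l 0 (fps_of_int_coeffs f)"
  by (simp add: fps_vge_def vge_of_int)

lemma fps_vge_compose: "fps_vge l e f \<Longrightarrow> fps_vge l e (f oo fps_X ^ k)"
  by (simp add: fps_vge_def fps_nth_compose_X_power)

lemma fps_vge_of_nat: "fps_vge l 1 (- of_nat l)"
  using vge_of_int[of l 1 "- int l"] by (auto simp: fps_vge_def fps_of_nat[symmetric])

lemma fps_vge_X_power: "fps_vge l 0 (fps_X ^ n)"
  using vge_of_int[of l 0 1] by (auto simp: fps_vge_def fps_X_power_nth)

text \<open>A constant term prime to l is an l-adic unit, so the coefficients of f can be solved for
  one by one.\<close>

lemma fps_vge_cancel:
  assumes "fps_vge l e (f * g)" "fps_vge l 0 g" "fps_nth g 0 = of_int b" "coprime b (int l)"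
  shows "fps_vge l e f"
  unfolding fps_vge_def
proof
  fix n
  show "vge l e (fps_nth f n)"
  proof (induction n rule: less_induct)
    case (less n)
    have "fps_nth (f * g) n = fps_nth f n * of_int b + (\<Sum>i<n. fps_nth f i * fps_nth g (n - i))"
      by (simp add: fps_mult_nth assms(3) atLeast0AtMost lessThan_Suc_atMost[symmetric])
    moreover have "vge l e (\<Sum>i<n. fps_nth f i * fps_nth g (n - i))"
      using less assms(2) vge_mult[of l e _ 0] by (intro vge_sum) (auto simp: fps_vge_def)
    moreover have "vge l e (fps_nth (f * g) n)" using assms(1) by (simp add: fps_vge_def)
    ultimately have "vge l e (fps_nth f n * of_int b)" using vge_diff by fastforce
    then show ?case using assms(4) by (rule vge_cancel)
  qed
qed

lemma power_diff_factor_nth_0: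
  fixes f g :: "rat fps"
  assumes "fps_nth f 0 = 1" "fps_nth g 0 = 1"
  shows "fps_nth (\<Sum>i<b. g ^ (b - Suc i) * f ^ i) 0 = of_int (int b)"
  using assms by (simp add: fps_sum_nth fps_power_zeroth)

lemma fps_vge_root:
  assumes f0: "fps_nth f 0 = 1" and fb: "fps_vge l 0 (f ^ b)" and b: "coprime (int b) (int l)"
  shows "fps_vge l 0 f"
  unfolding fps_vge_def
proof
  fix n
  show "vge l 0 (fps_nth f n)"
  proof (induction n rule: less_induct)
    case (less n)
    show ?case
    proof (cases "n = 0")
      case True
      then show ?thesis using vge_of_int[of l 0 1] f0 by simp
    next
      case False
      \<comment> \<open>Truncation of f below degree n: it is integral by induction, and the
        coefficient of degree n in f^b - g^b is b times that of f.\<close>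
      define g where "g = Abs_fps (\<lambda>i. if i < n then fps_nth f i else 0)"
      let ?S = "\<Sum>i<b. g ^ (b - Suc i) * f ^ i"
      have "fps_vge l 0 g" using less by (simp add: fps_vge_def g_def)
      then have "fps_vge l 0 (f ^ b - g ^ b)" by (intro fps_vge_diff fb fps_vge_power)
      then have "vge l 0 (fps_nth (f ^ b - g ^ b) n)" by (simp only: fps_vge_def)
      also have "fps_nth (f ^ b - g ^ b) n = (\<Sum>i\<in>{n}. fps_nth (f - g) i * fps_nth ?S (n - i))"
        unfolding power_diff_sumr2 fps_mult_nth
        by (rule sum.mono_neutral_right) (auto simp: g_def)
      also have "\<dots> = fps_nth f n * of_int (int b)"
        using power_diff_factor_nth_0[of f g b] f0 False by (simp add: g_def)
      finally show ?thesis using b by (rule vge_cancel)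
    qed
  qed
qed

lemma fps_const_dvd_iff:
  fixes c :: "'a::comm_ring_1"
  shows "fps_const c dvd f \<longleftrightarrow> (\<forall>n. c dvd fps_nth f n)"
proof
  assume "\<forall>n. c dvd fps_nth f n"
  then obtain g where "\<forall>n. fps_nth f n = c * g n" unfolding dvd_def by metis
  then have "f = fps_const c * Abs_fps g" by (simp add: fps_eq_iff)
  then show "fps_const c dvd f" by (metis dvdI)
qed (auto elim!: dvdE)

lemma fps_vge_if_dvd:
  assumes "of_nat l ^ e dvd f"
  shows "fps_vge l e (fps_of_int_coeffs f)"
proof -
  have "fps_const (int l ^ e) dvd f"
    using assms by (simp add: fps_of_nat[symmetric] fps_const_power)
  then show ?thesis by (simp add: fps_vge_def fps_const_dvd_iff vge_of_int)
qed

subsection \<open>Frobenius congruences\<close>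

lemma prime_dvd_power_add_diff:
  fixes a b :: "'a::comm_ring_1"
  assumes "prime p"
  shows "of_nat p dvd (a + b) ^ p - (a ^ p + b ^ p)"
proof -
  have p: "p > 0" using assms prime_gt_0_nat by simp
  have "(a + b) ^ p = (\<Sum>k\<le>p. of_nat (p choose k) * a ^ k * b ^ (p - k))"
    by (rule binomial_ring)
  also have "{..p} = insert 0 (insert p {0<..<p})" by auto
  also have "(\<Sum>k\<in>\<dots>. of_nat (p choose k) * a ^ k * b ^ (p - k))
      = b ^ p + a ^ p + (\<Sum>k\<in>{0<..<p}. of_nat (p choose k) * a ^ k * b ^ (p - k))"
    using p by simp
  finally have "(a + b) ^ p - (a ^ p + b ^ p) = (\<Sum>k\<in>{0<..<p}. of_nat (p choose k) * a ^ k * b ^ (p - k))"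
    by simp
  moreover have "of_nat p dvd (of_nat (p choose k) :: 'a)" if "k \<in> {0<..<p}" for k
    using dvd_choose_prime[of k p] that assms by (auto elim!: dvdE)
  ultimately show ?thesis by (auto intro!: dvd_sum dvd_mult2 simp: mult.assoc)
qed

text \<open>In a^p - b^p = (a - b) S the factor S is congruent to p b^(p-1) modulo p, so it
  contributes one more p.\<close>

lemma dvd_power_prime_lift:
  fixes a b :: "'a::comm_ring_1"
  assumes "of_nat p ^ Suc i dvd a - b"
  shows "of_nat p ^ Suc (Suc i) dvd a ^ p - b ^ p"
proof -
  have ab: "of_nat p dvd a - b" using assms dvd_mult_left by auto
  have "of_nat p dvd (\<Sum>j<p. b ^ (p - Suc j) * a ^ j) - (\<Sum>j<p. b ^ (p - Suc j) * b ^ j)"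
    unfolding sum_subtractf[symmetric] right_diff_distrib[symmetric]
    using dvd_power_diff[OF ab] by (intro dvd_sum dvd_mult)
  moreover have "(\<Sum>j<p. b ^ (p - Suc j) * b ^ j) = of_nat p * b ^ (p - 1)"
    by (simp add: power_add[symmetric])
  ultimately have "of_nat p dvd (\<Sum>j<p. b ^ (p - Suc j) * a ^ j)"
    by (metis dvd_triv_left dvd_add_times_triv_left_iff diff_add_cancel dvd_add)
  then have "of_nat p ^ Suc i * of_nat p dvd (a - b) * (\<Sum>j<p. b ^ (p - Suc j) * a ^ j)"
    using assms by (intro mult_dvd_mono)
  then show ?thesis unfolding power_diff_sumr2 by (simp only: power_Suc mult_ac)
qed

lemma qprod_compose:
  fixes c :: "'a::idom"
  assumes "m > 0" "l > 0"
  shows "(qprod c m r oo fps_X ^ l) = qprod c (l * m) (l * r)"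
proof -
  have l0: "fps_nth (fps_X ^ l :: 'a fps) 0 = 0" using assms(2) by simp
  have "((1 + fps_const c * fps_X ^ k) oo fps_X ^ l) = 1 + fps_const c * fps_X ^ (l * k)" for k
    by (simp add: fps_compose_add_distrib fps_compose_mult_distrib[OF l0] fps_compose_power[OF l0, symmetric]
        fps_X_fps_compose_startby0[OF l0] power_mult)
  then show ?thesis
    unfolding qprod_def lprod_compose[OF stabilising_qprod[OF assms(1)] assms(2)]
    by (simp add: algebra_simps)
qed

lemma qprod_Frobenius:
  fixes l :: nat
  assumes "prime l" "odd l" "m > 0"
  shows "of_nat l dvd qprod (- 1 :: int) m r ^ l - (qprod (- 1) m r oo fps_X ^ l)"
proof -
  let ?f = "\<lambda>j. 1 + fps_const (- 1 :: int) * fps_X ^ (m * j + r)"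
  let ?g = "\<lambda>j. 1 + fps_const (- 1 :: int) * fps_X ^ (l * m * j + l * r)"
  have l: "l > 0" using assms(1) prime_gt_0_nat by simp
  have "of_nat l dvd ?f j ^ l - ?g j" for j
  proof -
    have "?g j = 1 ^ l + (- (fps_X ^ (m * j + r))) ^ l"
      using assms(2) by (simp add: fps_const_minus_one power_mult[symmetric] algebra_simps)
    moreover have "?f j = 1 + - (fps_X ^ (m * j + r))" by (simp add: fps_const_minus_one)
    ultimately show ?thesis using prime_dvd_power_add_diff[OF assms(1)] by (simp only:)
  qed
  then have "of_nat l dvd (\<Prod>j<n. ?f j ^ l) - (\<Prod>j<n. ?g j)" for n
    by (rule dvd_prod_diff)
  then have dvd: "int l dvd fps_nth ((\<Prod>j<n. ?f j ^ l) - (\<Prod>j<n. ?g j)) k" for n k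
    by (simp add: fps_of_nat[symmetric] fps_const_dvd_iff)
  \<comment> \<open>The factorwise congruence passes to the limit because each coefficient is that
    of a finite product.\<close>
  have "of_nat l dvd lprod (\<lambda>j. ?f j ^ l) - lprod ?g"
    using dvd[of "Suc _"]
    by (simp add: fps_of_nat[symmetric] fps_const_dvd_iff lprod_def del: prod.lessThan_Suc)
  then show ?thesis
    unfolding qprod_compose[OF assms(3) l] unfolding qprod_def
    by (simp add: lprod_power[OF stabilising_qprod[OF assms(3)]])
qed

lemma euler_pair_Frobenius:
  fixes l :: nat
  assumes "prime l" "odd l" "u > 0"
  shows "of_nat l ^ Suc N dvd (euler_pair u :: int fps) ^ (l ^ Suc N) - (euler_pair u oo fps_X ^ l) ^ (l ^ N)"
proof (induction N)
  case 0
  have "fps_nth (fps_X ^ l :: int fps) 0 = 0" using assms(1) prime_gt_0_nat by simp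
  then show ?case
    using dvd_mult_diff[OF qprod_Frobenius[OF assms(1,2), of 1 1] qprod_Frobenius[OF assms(1,2,3), of u]]
    by (simp add: euler_pair_def fps_compose_mult_distrib power_mult_distrib)
next
  case (Suc N)
  from dvd_power_prime_lift[OF this] show ?case
    by (simp add: power_mult[symmetric] mult.commute)
qed

lemma fps_of_int_coeffs_diff: "fps_of_int_coeffs (f - g) = fps_of_int_coeffs f - fps_of_int_coeffs g"
  by (simp add: fps_eq_iff)

lemma fps_of_int_coeffs_compose:
  "fps_of_int_coeffs (f oo fps_X ^ k) = (fps_of_int_coeffs f oo fps_X ^ k)"
  by (simp add: fps_eq_iff fps_nth_compose_X_power)

lemma self_similar_of_int_coeffs':
  "self_similar l \<sigma> \<rho> f \<Longrightarrow> self_similar l \<sigma> \<rho> (fps_of_int_coeffs f)"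
  by (simp add: self_similar_def)

subsection \<open>Coefficients along arithmetic progressions\<close>

lemma fps_binomial_power_add:
  assumes "fps_nth f 0 = 1"
  shows "fps_binomial_power f (s + t) = fps_binomial_power f s * fps_binomial_power f t"
  using assms by (simp add: fps_binomial_power_def fps_binomial_add_mult fps_compose_mult_distrib)

lemma fps_binomial_power_of_nat:
  assumes "fps_nth f 0 = 1"
  shows "fps_binomial_power f (of_nat n) = f ^ n"
  using assms by (simp add: fps_binomial_power_def fps_binomial_of_nat fps_compose_power[symmetric]
      fps_compose_add_distrib)

lemma fps_binomial_power_power:
  assumes "fps_nth f 0 = 1"
  shows "fps_binomial_power f t ^ n = fps_binomial_power f (of_nat n * t)"
  using assms by (simp add: fps_binomial_power_def fps_compose_power fps_binomial_power)

lemma stabilising_p_factor: "u > 0 \<Longrightarrow> stabilising (p_factor u t)"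
  by (auto simp: stabilising_def fps_X_power_dvd_iff p_factor_nth)

text \<open>Bridge from the topological product to \<open>lprod\<close>: convergence makes each
  coefficient of the partial products eventually constant, and the two limits are compared at a late
  index.\<close>

lemma p_gen_eq_lprod:
  assumes "u > 0"
  shows "p_gen u t = lprod (p_factor u t)"
proof (rule lprodI[symmetric], unfold fps_X_power_dvd_iff, intro allI impI)
  fix n i :: nat assume "i < n"
  have "p_factor u t j \<noteq> 0" for j
    using p_factor_nth[OF assms, of 0 j t] by auto
  then have "raw_has_prod (p_factor u t) 0 (p_gen u t)"
    using p_factor_has_prod[OF assms, of t] by (simp add: has_prod_def)
  then have "(\<lambda>m. \<Prod>j\<le>m. p_factor u t j) \<longlonglongrightarrow> p_gen u t"
    by (simp add: raw_has_prod_def)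
  then have "eventually (\<lambda>m. fps_nth (\<Prod>j\<le>m. p_factor u t j) i = fps_nth (p_gen u t) i) sequentially"
    by (simp add: tendsto_fps_iff)
  then obtain M where M: "\<And>m. m \<ge> M \<Longrightarrow> fps_nth (\<Prod>j<Suc m. p_factor u t j) i = fps_nth (p_gen u t) i"
    unfolding eventually_sequentially lessThan_Suc_atMost by blast
  have "fps_nth (lprod (p_factor u t)) i = fps_nth (\<Prod>j<k. p_factor u t j) i" if "i < k" for k
    using dvd_lprod[OF stabilising_p_factor[OF assms], of k t] that by (simp add: fps_X_power_dvd_iff)
  from this[of n] this[of "Suc (max M i)"] M[of "max M i"] \<open>i < n\<close>
  show "fps_nth (p_gen u t - (\<Prod>j<n. p_factor u t j)) i = 0" by (simp del: prod.lessThan_Suc)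
qed

text \<open>The b-th power removes the denominator of the exponent; with the negative part moved to
  the left, only natural powers of F remain.\<close>

lemma p_gen_power:
  fixes b :: nat
  assumes "u > 0" "of_nat b * t = of_nat n - of_nat m"
  shows "p_gen u t ^ b * euler_pair u ^ m = euler_pair u ^ n"
proof -
  let ?g = "\<lambda>j. (1 - fps_X ^ Suc j) * (1 - fps_X ^ (u * Suc j)) :: rat fps"
  let ?f1 = "\<lambda>j. 1 + fps_const (- 1 :: rat) * fps_X ^ (1 * j + 1)"
  let ?fu = "\<lambda>j. 1 + fps_const (- 1 :: rat) * fps_X ^ (u * j + u)"
  have g: "?g = (\<lambda>j. ?f1 j * ?fu j)"
    by (simp add: fps_const_minus_one algebra_simps)
  have stab: "stabilising ?g"
    unfolding g using assms(1) by (intro stabilising_mult stabilising_qprod) auto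
  have E: "lprod ?g = euler_pair u"
    unfolding g euler_pair_def qprod_def using assms(1) by (intro lprod_mult stabilising_qprod) auto
  have "p_factor u t j ^ b * ?g j ^ m = ?g j ^ n" for j
  proof -
    have "fps_nth (?g j) 0 = 1" using assms(1) by simp
    note bin = fps_binomial_power_power[OF this] fps_binomial_power_of_nat[OF this, symmetric]
      fps_binomial_power_add[OF this, symmetric]
    show ?thesis unfolding p_factor_def bin assms(2) by simp
  qed
  then have "lprod (\<lambda>j. p_factor u t j ^ b * ?g j ^ m) = lprod (\<lambda>j. ?g j ^ n)" by simp
  then show ?thesis
    using stab stabilising_p_factor[OF assms(1), of t]
    by (simp only: lprod_mult lprod_power stabilising_power E p_gen_eq_lprod[OF assms(1)])
qed

lemma p_gen_nth_0: "u > 0 \<Longrightarrow> fps_nth (p_gen u t) 0 = 1"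
  by (simp add: p_gen_eq_lprod lprod_nth_0 p_factor_nth)

text \<open>Sections along a residue class are linear over series in q^l. As \<rho> < l, the
  multiples of l up to \<open>l * n + \<rho>\<close> are the l i with i \<le> n.\<close>

lemma nth_mult_compose:
  fixes f g :: "'a::comm_ring_1 fps"
  assumes "\<rho> < l"
  shows "fps_nth (f * (g oo fps_X ^ l)) (l * n + \<rho>)
    = fps_nth (Abs_fps (\<lambda>k. fps_nth f (l * k + \<rho>)) * g) n"
proof -
  have l: "l > 0" using assms by simp
  have "fps_nth ((g oo fps_X ^ l) * f) (l * n + \<rho>)
      = (\<Sum>k=0..l * n + \<rho>. (if l dvd k then fps_nth g (k div l) else 0) * fps_nth f (l * n + \<rho> - k))"
    by (simp add: fps_mult_nth fps_nth_compose_X_power)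
  also have "\<dots> = (\<Sum>k\<in>(\<lambda>i. l * i) ` {0..n}. (if l dvd k then fps_nth g (k div l) else 0) * fps_nth f (l * n + \<rho> - k))"
  proof (rule sum.mono_neutral_right)
    show "(\<lambda>i. l * i) ` {0..n} \<subseteq> {0..l * n + \<rho>}" by (auto intro!: trans_le_add1 mult_le_mono2)
    have "i \<le> n" if "l * i \<le> l * n + \<rho>" for i
    proof (rule ccontr)
      assume "\<not> i \<le> n"
      then have "l * Suc n \<le> l * i" by (intro mult_le_mono2) simp
      with that assms show False by simp
    qed
    then show "\<forall>k\<in>{0..l * n + \<rho>} - (\<lambda>i. l * i) ` {0..n}.
        (if l dvd k then fps_nth g (k div l) else 0) * fps_nth f (l * n + \<rho> - k) = 0"
      by (auto elim!: dvdE)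
  qed simp
  also have "\<dots> = (\<Sum>i=0..n. fps_nth g i * fps_nth f (l * n + \<rho> - l * i))"
    using l by (subst sum.reindex) (auto simp: inj_on_def)
  also have "\<dots> = (\<Sum>i=0..n. fps_nth g i * fps_nth f (l * (n - i) + \<rho>))"
    by (intro sum.cong) (auto simp: diff_mult_distrib2)
  finally show ?thesis by (simp add: fps_mult_nth mult.commute[of _ g] mult.commute[of f])
qed

text \<open>The step is the index map of \<open>self_similar\<close>; undoing it s times leads back
  to \<open>l * k + \<rho>\<close>, where the coefficient of F^2 vanishes for k outside the class
  \<sigma>.\<close>

fun iterated_index :: "nat \<Rightarrow> nat \<Rightarrow> nat \<Rightarrow> nat \<Rightarrow> nat \<Rightarrow> nat" where
  "iterated_index l \<sigma> \<rho> k 0 = l * k + \<rho>"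
| "iterated_index l \<sigma> \<rho> k (Suc s) = l * (l * iterated_index l \<sigma> \<rho> k s + \<sigma>) + \<rho>"

lemma not_dvd_diff_if_mod_noteq:
  fixes k l \<sigma> :: nat
  assumes "k mod l \<noteq> \<sigma>" "\<sigma> < l" "\<not> k < \<sigma>"
  shows "\<not> l dvd k - \<sigma>"
proof
  assume "l dvd k - \<sigma>"
  then obtain n where "k - \<sigma> = l * n" by (rule dvdE)
  with assms(3) have "k = l * n + \<sigma>" by simp
  with assms(1,2) show False by simp
qed

section \<open>Congruences at an inert prime\<close>

locale inert_prime =
  fixes l u \<sigma> \<rho> :: nat
  assumes prime: "prime l" and odd: "odd l" and u: "u > 0" and \<sigma>: "\<sigma> < l" and \<rho>: "\<rho> < l"
    and self_similar: "self_similar l \<sigma> \<rho> (euler_pair u ^ 2 :: int fps)"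
begin

text \<open>Characterises F^(-l^N/b), the series \<open>X\<^sub>N\<close> of the overview, by
  natural powers and constant term 1.\<close>

definition is_root :: "nat \<Rightarrow> nat \<Rightarrow> rat fps \<Rightarrow> bool" where
  "is_root b N f \<longleftrightarrow> fps_nth f 0 = 1 \<and> f ^ b * euler_pair u ^ (l ^ N) = 1"

lemma l_pos: "l > 0"
  using \<rho> by simp

lemma X_power_nth_0: "fps_nth (fps_X ^ l :: rat fps) 0 = 0"
  using l_pos by simp

lemma euler_pair_nth_0: "fps_nth (euler_pair u) 0 = (1 :: rat)"
  using u by (simp add: euler_pair_def qprod_nth_0)

lemma euler_pair_integral: "fps_vge l 0 (euler_pair u)"
  using fps_vge_of_int_coeffs[of l "euler_pair u"] by (simp only: fps_of_int_coeffs_euler_pair)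

lemma section_self_similar:
  "Abs_fps (\<lambda>k. fps_nth (euler_pair u ^ 2 :: rat fps) (l * k + \<rho>))
    = - of_nat l * (fps_X ^ \<sigma> * (euler_pair u ^ 2 oo fps_X ^ l))"
proof (rule fps_ext)
  fix k
  let ?A = "euler_pair u ^ 2 :: rat fps"
  have "self_similar l \<sigma> \<rho> ?A"
    using self_similar_of_int_coeffs'[OF self_similar]
    by (simp only: fps_of_int_coeffs_power fps_of_int_coeffs_euler_pair)
  then have A: "fps_nth ?A (l * (l * n + \<sigma>) + \<rho>) = - of_nat l * fps_nth ?A n"
    "k mod l \<noteq> \<sigma> \<Longrightarrow> fps_nth ?A (l * k + \<rho>) = 0" for n k
    unfolding self_similar_def by blast+
  have r: "fps_nth (- of_nat l * (fps_X ^ \<sigma> * (?A oo fps_X ^ l))) k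
      = - of_nat l * (if k < \<sigma> then 0 else if l dvd k - \<sigma> then fps_nth ?A ((k - \<sigma>) div l) else 0)"
    by (simp add: fps_of_nat[symmetric] fps_X_power_mult_nth fps_nth_compose_X_power)
  show "fps_nth (Abs_fps (\<lambda>k. fps_nth ?A (l * k + \<rho>))) k = fps_nth (- of_nat l * (fps_X ^ \<sigma> * (?A oo fps_X ^ l))) k"
  proof (cases "k mod l = \<sigma>")
    case True
    then have "k = l * (k div l) + \<sigma>" by (metis mult_div_mod_eq)
    then obtain n where k: "k = l * n + \<sigma>" by blast
    show ?thesis unfolding r using A(1)[of n] l_pos by (simp add: k)
  next
    case False
    then show ?thesis
      unfolding r using A(2)[OF False] not_dvd_diff_if_mod_noteq[OF False \<sigma>] by simp
  qed
qed

context
  fixes b :: nat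
  assumes b: "coprime (int b) (int l)"
begin

lemma root_integral:
  assumes "is_root b N f"
  shows "fps_vge l 0 f"
proof (rule fps_vge_root[OF _ _ b])
  have "fps_vge l 0 (f ^ b * euler_pair u ^ (l ^ N))"
    using assms fps_vge_1 by (simp add: is_root_def)
  then show "fps_vge l 0 (f ^ b)"
    by (rule fps_vge_cancel[where b = 1])
       (simp_all add: fps_vge_power euler_pair_integral fps_power_zeroth euler_pair_nth_0
         del: fps_mult_nth_0)
qed (use assms in \<open>simp add: is_root_def\<close>)

text \<open>The b-th powers of f and g(q^l) are inverse to powers of F and F(q^l) that agree modulo
  l^(N+1) by Frobenius. The cofactor of the difference of b-th powers has constant term b, prime to
  l, and is cancelled.\<close>

lemma root_cong:
  assumes f: "is_root b (Suc N) f" and g: "is_root b N g"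
  shows "fps_vge l (Suc N) (f - (g oo fps_X ^ l))"
proof (rule fps_vge_cancel[OF _ _ power_diff_factor_nth_0 b])
  let ?g = "g oo fps_X ^ l"
  let ?E = "euler_pair u :: rat fps"
  let ?E' = "?E oo fps_X ^ l"
  show 0: "fps_nth f 0 = 1" "fps_nth ?g 0 = 1"
    using f g by (simp_all add: is_root_def)
  have int: "fps_vge l 0 f" "fps_vge l 0 ?g"
    using f g by (auto intro: root_integral fps_vge_compose)
  then show "fps_vge l 0 (\<Sum>i<b. ?g ^ (b - Suc i) * f ^ i)"
    using fps_vge_mult[of l 0 _ 0] by (intro fps_vge_sum) (simp add: fps_vge_power)
  have f1: "f ^ b * ?E ^ (l ^ Suc N) = 1" using f by (simp add: is_root_def)
  have g1: "?g ^ b * ?E' ^ (l ^ N) = 1"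
    using g arg_cong[of _ _ "\<lambda>h. h oo fps_X ^ l"]
    by (simp add: is_root_def fps_compose_power[OF X_power_nth_0]
        fps_compose_mult_distrib[OF X_power_nth_0, symmetric])
  have "fps_vge l (Suc N) (fps_of_int_coeffs (euler_pair u ^ (l ^ Suc N) - (euler_pair u oo fps_X ^ l) ^ (l ^ N)))"
    by (intro fps_vge_if_dvd euler_pair_Frobenius prime odd u)
  then have "fps_vge l (Suc N) (?E ^ (l ^ Suc N) - ?E' ^ (l ^ N))"
    by (simp only: fps_of_int_coeffs_diff fps_of_int_coeffs_power fps_of_int_coeffs_compose
        fps_of_int_coeffs_euler_pair)
  moreover have "fps_vge l 0 (- (f ^ b * ?g ^ b))"
    using fps_vge_diff[of l 0 0] fps_vge_mult[of l 0 _ 0] int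
    by (simp add: fps_vge_power fps_vge_def[of _ _ 0])
  ultimately have "fps_vge l (0 + Suc N) (- (f ^ b * ?g ^ b) * (?E ^ (l ^ Suc N) - ?E' ^ (l ^ N)))"
    by (intro fps_vge_mult)
  also have "- (f ^ b * ?g ^ b) * (?E ^ (l ^ Suc N) - ?E' ^ (l ^ N))
      = f ^ b * (?g ^ b * ?E' ^ (l ^ N)) - (f ^ b * ?E ^ (l ^ Suc N)) * ?g ^ b"
    by (simp add: algebra_simps)
  also have "\<dots> = (f - ?g) * (\<Sum>i<b. ?g ^ (b - Suc i) * f ^ i)"
    unfolding f1 g1 power_diff_sumr2[symmetric] by simp
  finally show "fps_vge l (Suc N) ((f - ?g) * (\<Sum>i<b. ?g ^ (b - Suc i) * f ^ i))" by simp
qed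

lemma coefficient_step:
  assumes X: "\<And>N. is_root b N (X N)"
  shows "vge l (Suc N) (fps_nth (euler_pair u ^ 2 * X (Suc N)) (l * k + \<rho>)
    - fps_nth (- of_nat l * (fps_X ^ \<sigma> * (euler_pair u ^ 2 oo fps_X ^ l)) * X N) k)"
proof -
  let ?A = "euler_pair u ^ 2 :: rat fps"
  have "fps_vge l (0 + Suc N) (?A * (X (Suc N) - (X N oo fps_X ^ l)))"
    by (intro fps_vge_mult fps_vge_power euler_pair_integral root_cong X)
  then have "vge l (Suc N) (fps_nth (?A * X (Suc N)) (l * k + \<rho>) - fps_nth (?A * (X N oo fps_X ^ l)) (l * k + \<rho>))"
    by (simp add: fps_vge_def right_diff_distrib)
  then show ?thesis
    unfolding nth_mult_compose[OF \<rho>] section_self_similar .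
qed

text \<open>The second replacement of X is valid modulo l^(N+1) only, but the factor -l from the
  section of F^2 raises this to l^(N+2).\<close>

lemma coefficient_two_steps:
  assumes X: "\<And>N. is_root b N (X N)"
  shows "vge l (Suc (Suc N)) (fps_nth (euler_pair u ^ 2 * X (Suc (Suc N))) (l * k + \<rho>)
    - fps_nth (- of_nat l * (fps_X ^ \<sigma> * ((euler_pair u ^ 2 * X N) oo fps_X ^ l))) k)"
proof -
  let ?A = "euler_pair u ^ 2 :: rat fps"
  have "fps_vge l (1 + 0 + (0 + Suc N)) (- of_nat l * fps_X ^ \<sigma> * ((?A oo fps_X ^ l) * (X (Suc N) - (X N oo fps_X ^ l))))"
    by (intro fps_vge_mult fps_vge_compose fps_vge_power euler_pair_integral root_cong X
        fps_vge_of_nat fps_vge_X_power)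
  also have "- of_nat l * fps_X ^ \<sigma> * ((?A oo fps_X ^ l) * (X (Suc N) - (X N oo fps_X ^ l)))
    = - of_nat l * (fps_X ^ \<sigma> * (?A oo fps_X ^ l)) * X (Suc N)
      - - of_nat l * (fps_X ^ \<sigma> * ((?A * X N) oo fps_X ^ l))"
    by (simp only: fps_compose_mult_distrib[OF X_power_nth_0] right_diff_distrib mult.assoc)
  finally have "vge l (Suc (Suc N)) (fps_nth (- of_nat l * (fps_X ^ \<sigma> * (?A oo fps_X ^ l)) * X (Suc N)) k
      - fps_nth (- of_nat l * (fps_X ^ \<sigma> * ((?A * X N) oo fps_X ^ l))) k)"
    by (simp only: fps_vge_def fps_sub_nth) simp
  from vge_add[OF coefficient_step[OF X, of "Suc N" k] this] show ?thesis by simp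
qed

text \<open>Two steps lower N by 2 but produce a factor l, so each descent costs one exponent. At
  the end, k outside the class \<sigma> makes the main term of \<open>coefficient_two_steps\<close>
  vanish.\<close>

lemma coefficient_divisible:
  assumes X: "\<And>N. is_root b N (X N)" and k: "k mod l \<noteq> \<sigma>"
  shows "vge l (N - s) (fps_nth (euler_pair u ^ 2 * X N) (iterated_index l \<sigma> \<rho> k s))"
proof (induction s arbitrary: N)
  let ?A = "euler_pair u ^ 2 :: rat fps"
  have int: "fps_vge l 0 (X N)" for N by (rule root_integral[OF X])
  have int': "fps_vge l (0 + 0) (?A * X N)" for N
    by (intro fps_vge_mult fps_vge_power euler_pair_integral int)
  case 0
  \<comment> \<open>Two steps need N \<ge> 2; for N = 1 the factor -l of one step suffices, for N =
    0 integrality.\<close>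
  consider "N = 0" | "N = 1" | M where "N = Suc (Suc M)"
    by (metis One_nat_def not0_implies_Suc)
  then show ?case
  proof cases
    case 1
    then show ?thesis using int'[of 0] by (simp add: fps_vge_def)
  next
    case 2
    have "fps_vge l (1 + (0 + 0) + 0) (- of_nat l * (fps_X ^ \<sigma> * (?A oo fps_X ^ l)) * X 0)"
      by (intro fps_vge_mult fps_vge_of_nat fps_vge_X_power fps_vge_compose fps_vge_power euler_pair_integral int)
    then have "vge l (Suc 0) (fps_nth (- of_nat l * (fps_X ^ \<sigma> * (?A oo fps_X ^ l)) * X 0) k)"
      by (simp only: fps_vge_def) simp
    from vge_add[OF coefficient_step[OF X, of 0 k] this] show ?thesis by (simp add: 2)
  next
    case 3
    have eq0: "fps_nth (- of_nat l * (fps_X ^ \<sigma> * ((?A * X M) oo fps_X ^ l))) k = 0"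
      using not_dvd_diff_if_mod_noteq[OF k \<sigma>]
      by (simp add: fps_of_nat[symmetric] fps_X_power_mult_nth fps_nth_compose_X_power)
    show ?thesis using coefficient_two_steps[OF X, of M k] unfolding eq0 by (simp add: 3)
  qed
next
  let ?A = "euler_pair u ^ 2 :: rat fps"
  case (Suc s)
  show ?case
  proof (cases "N - Suc s")
    case 0
    have "fps_vge l (0 + 0) (?A * X N)"
      by (intro fps_vge_mult fps_vge_power euler_pair_integral root_integral[OF X])
    then show ?thesis by (simp only: 0 fps_vge_def) simp
  next
    case (Suc M')
    then obtain M where N: "N = Suc (Suc M)" by (metis Suc_diff_Suc diff_0_eq_0 nat.exhaust zero_diff diff_Suc_Suc nat.distinct(1))
    let ?i = "iterated_index l \<sigma> \<rho> k s"
    have "fps_nth (- of_nat l * (fps_X ^ \<sigma> * ((?A * X M) oo fps_X ^ l))) (l * ?i + \<sigma>)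
        = of_int (- int l) * fps_nth (?A * X M) ?i"
      using l_pos by (simp add: fps_of_nat[symmetric] fps_X_power_mult_nth fps_nth_compose_X_power)
    \<comment> \<open>One exponent from -l and M - s by induction, with M = N - 2; the sum is at
      least \<open>N - Suc s\<close>.\<close>
    moreover have "vge l (1 + (M - s)) (of_int (- int l) * fps_nth (?A * X M) ?i)"
      by (intro vge_mult vge_of_int Suc.IH) simp
    ultimately have "vge l (N - Suc s) (fps_nth (- of_nat l * (fps_X ^ \<sigma> * ((?A * X M) oo fps_X ^ l))) (l * ?i + \<sigma>))"
      using N by (auto intro: vge_mono)
    moreover have "vge l (N - Suc s) (fps_nth (?A * X N) (iterated_index l \<sigma> \<rho> k (Suc s))
        - fps_nth (- of_nat l * (fps_X ^ \<sigma> * ((?A * X M) oo fps_X ^ l))) (l * ?i + \<sigma>))"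
      using coefficient_two_steps[OF X, of M "l * ?i + \<sigma>"] unfolding N by (auto intro: vge_mono)
    ultimately show ?thesis using vge_add by fastforce
  qed
qed

end

text \<open>The exponent is 2 - l^N/b, so dividing the generating function by F^2 yields
  \<open>X\<^sub>N\<close>.\<close>

lemma p_coeff_cong:
  fixes b :: int
  assumes "b > 0" "coprime b (int l)" "k mod l \<noteq> \<sigma>"
  shows "rat_cong_zero (p_coeff u (- (of_nat l ^ N - 2 * of_int b) / of_int b) (iterated_index l \<sigma> \<rho> k s)) (int l ^ (N - s))"
proof -
  obtain c :: nat where c: "b = int c" "c > 0" using assms(1) by (metis zero_less_imp_eq_int)
  define P where "P N = p_gen u (- (of_nat l ^ N - 2 * of_int b) / of_int b)" for N
  define X where "X N = P N * inverse (euler_pair u) ^ 2" for N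
  let ?E = "euler_pair u :: rat fps"
  have E: "?E * inverse ?E = 1"
    using euler_pair_nth_0 by (simp add: inverse_mult_eq_1')
  have "is_root c N (X N)" for N
  proof -
    have "P N ^ c * ?E ^ (l ^ N) = ?E ^ (2 * c)"
      unfolding P_def by (rule p_gen_power[OF u]) (use c in \<open>simp add: field_simps\<close>)
    then have "(P N ^ c * ?E ^ (l ^ N)) * inverse ?E ^ (2 * c) = (?E * inverse ?E) ^ (2 * c)"
      by (simp only: power_mult_distrib)
    then have "X N ^ c * ?E ^ (l ^ N) = 1"
      unfolding E X_def by (simp add: power_mult_distrib power_mult[symmetric] mult_ac)
    moreover have "fps_nth (X N) 0 = 1"
      using p_gen_nth_0[OF u] euler_pair_nth_0 by (simp add: X_def P_def fps_power_zeroth)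
    ultimately show ?thesis by (simp add: is_root_def)
  qed
  then have "vge l (N - s) (fps_nth (?E ^ 2 * X N) (iterated_index l \<sigma> \<rho> k s))"
    using assms(2,3) c(1) coefficient_divisible by simp
  also have "?E ^ 2 * X N = P N * (?E * inverse ?E) ^ 2"
    unfolding X_def power_mult_distrib by (simp only: mult_ac)
  finally show ?thesis
    unfolding E by (simp add: P_def p_coeff_def rat_cong_zero_if_vge)
qed

end

section \<open>The cases \<open>l = 3\<close> and \<open>l = 5\<close>\<close>

interpretation mod_3: inert_prime 3 2 0 2
  by unfold_locales (use self_similar_2 in simp_all)

interpretation mod_5: inert_prime 5 3 1 3
  by unfold_locales (use self_similar_3 in simp_all)

text \<open>A step sends x to 9 x + 2, and the division by 4 is exact because even powers of 3 are 1
  modulo 4.\<close>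

lemma index_3: "iterated_index 3 0 2 (3 * n + r) s
  = 3 ^ (2 * Suc s) * n + 3 ^ (2 * Suc s - 1) * r + (3 ^ (2 * Suc s) - 1) div 4"
proof (induction s)
  case (Suc s)
  define y :: nat where "y = 3 ^ (2 * Suc s - 1)"
  have y: "(3::nat) ^ (2 * Suc s) = 3 * y" "(3::nat) ^ (2 * Suc (Suc s)) = 27 * y"
    "(3::nat) ^ (2 * Suc (Suc s) - 1) = 9 * y"
    by (simp_all add: y_def)
  have "\<exists>q. (3::nat) ^ (2 * Suc s) = 4 * q + 1"
  proof (induction s)
    case (Suc s)
    then obtain q where "(3::nat) ^ (2 * Suc s) = 4 * q + 1" by blast
    then have "(3::nat) ^ (2 * Suc (Suc s)) = 4 * (9 * q + 2) + 1" by simp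
    then show ?case by blast
  qed auto
  then obtain q where q: "3 * y = 4 * q + 1" unfolding y by blast
  then have "(27 * y - 1) div 4 = 9 * q + 2" "(3 * y - 1) div 4 = q" by simp_all
  with Suc show ?case unfolding y y_def[symmetric] by (simp add: algebra_simps)
qed simp

text \<open>A step sends x to 25 x + 8, and the division by 3 is exact because twice an odd power of
  5 is 1 modulo 3.\<close>

lemma index_5: "iterated_index 5 1 3 (5 * n + r) s
  = 5 ^ (2 * Suc s) * n + 5 ^ (2 * Suc s - 1) * r + (2 * 5 ^ (2 * Suc s - 1) - 1) div 3"
proof (induction s)
  case (Suc s)
  define y :: nat where "y = 5 ^ (2 * Suc s - 1)"
  have y: "(5::nat) ^ (2 * Suc s) = 5 * y" "(5::nat) ^ (2 * Suc (Suc s)) = 125 * y"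
    "(5::nat) ^ (2 * Suc (Suc s) - 1) = 25 * y"
    by (simp_all add: y_def)
  have "\<exists>q. 2 * (5::nat) ^ (2 * Suc s - 1) = 3 * q + 1"
  proof (induction s)
    case (Suc s)
    then obtain q where "2 * (5::nat) ^ (2 * Suc s - 1) = 3 * q + 1" by blast
    then have "2 * (5::nat) ^ (2 * Suc (Suc s) - 1) = 3 * (25 * q + 8) + 1" by simp
    then show ?case by blast
  qed (auto intro: exI[of _ 3])
  then obtain q where q: "2 * y = 3 * q + 1" unfolding y_def by blast
  then have "(2 * (25 * y) - 1) div 3 = 25 * q + 8" "(2 * y - 1) div 3 = q" by simp_all
  with Suc show ?case unfolding y y_def[symmetric] by (simp add: algebra_simps)
qed simp

theorem theorem1p19:
  fixes k m s :: nat
  assumes "k > 0" "m > 0" "s > 0" "s \<le> m + 1"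
  shows "(\<forall>n::nat. \<forall>r\<in>{1, 2::nat}. \<forall>b::int. b > 0 \<and> coprime b 3 \<longrightarrow>
            rat_cong_zero
              (p_coeff 2 (- (3 ^ (k + m) - 2 * of_int b) / of_int b)
                 (3 ^ (2 * s) * n + 3 ^ (2 * s - 1) * r + (3 ^ (2 * s) - 1) div 4))
              (3 ^ (k + m - s + 1)))
       \<and> (\<forall>n::nat. \<forall>r\<in>{0, 2, 3, 4::nat}. \<forall>b::int. b > 0 \<and> coprime b 5 \<longrightarrow>
            rat_cong_zero
              (p_coeff 3 (- (5 ^ (k + m) - 2 * of_int b) / of_int b)
                 (5 ^ (2 * s) * n + 5 ^ (2 * s - 1) * r + (2 * 5 ^ (2 * s - 1) - 1) div 3))
              (5 ^ (k + m - s + 1)))"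
proof -
  obtain t where s: "s = Suc t" using assms(3) gr0_implies_Suc by blast
  \<comment> \<open>The subtraction is not truncated, as k > 0 and s \<le> m + 1. The first section
    accounts for one unit of s, leaving t descents.\<close>
  have exp: "k + m - s + 1 = k + m - t" using assms s by simp
  show ?thesis
  proof (intro conjI allI ballI impI; elim conjE)
    fix n r :: nat and b :: int
    assume "r \<in> {1, 2}" "b > 0" "coprime b 3"
    \<comment> \<open>The residue r of \<open>3 * n + r\<close> differs from \<sigma> = 0; below,
      that of \<open>5 * n + r\<close> differs from \<sigma> = 1.\<close>
    then show "rat_cong_zero
        (p_coeff 2 (- (3 ^ (k + m) - 2 * of_int b) / of_int b)
           (3 ^ (2 * s) * n + 3 ^ (2 * s - 1) * r + (3 ^ (2 * s) - 1) div 4))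
        (3 ^ (k + m - s + 1))"
      using mod_3.p_coeff_cong[of b "3 * n + r" "k + m" t] unfolding exp
      unfolding s index_3 by auto
  next
    fix n r :: nat and b :: int
    assume "r \<in> {0, 2, 3, 4}" "b > 0" "coprime b 5"
    then show "rat_cong_zero
        (p_coeff 3 (- (5 ^ (k + m) - 2 * of_int b) / of_int b)
           (5 ^ (2 * s) * n + 5 ^ (2 * s - 1) * r + (2 * 5 ^ (2 * s - 1) - 1) div 3))
        (5 ^ (k + m - s + 1))"
      using mod_5.p_coeff_cong[of b "5 * n + r" "k + m" t] unfolding exp
      unfolding s index_5 by auto
  qed
qed

end
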